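(* Let $N\ge 1$, $R,d>0$, $h_0\in(0,1)$, and let $\Omega=(-R,R)\times(a,b)$ with $b>a\ge a_0$, where $a_0=a_0(N,R,d)>1$ is the number fixed in the context. Below, $C_{h_0}=C_{h_0}(N,\Omega,d,h_0)>0$ denotes constants depending only on the listed parameters (possibly different in different inequalities). The following holds for all $\varepsilon\in[0,1)$, all $\delta\in(0,1)$ and all $h\in[h_0,1)$ for which $K=2R/h$ is an integer. Let $\mathbf g^*,\mathbf g_\delta:\partial\Omega\to\mathbb R^N$ (noiseless and noisy data) vanish on $\{y=a\}$ and satisfy $\mathbf g^*(\pm R,\cdot),\mathbf g_\delta(\pm R,\cdot)\in C^1[a,b]$. Suppose there exist $\widetilde{\mathbf F}^{*,h}$ and $\widetilde{\mathbf F}^h_\delta$ with $\mathbf F^{*,h},\mathbf F^h_\delta\in H^{1,h}(\Omega^h)$ such that $$\mathbf F^{*,h}(a)=\mathbf 0,\ \mathbf F^{*,h}(b)=\mathbf g^{*,h}(b),\ \mathbf F^{*,h}_0(y)=\mathbf g^*(-R,y),\ \mathbf F^{*,h}_K(y)=\mathbf g^*(R,y),$$ that $\widetilde{\mathbf F}^h_\delta$ satisfies the same conditions with $\mathbf g^*$ replaced by $\mathbf g_\delta$, and that $$\|\mathbf F^h_\delta-\mathbf F^{*,h}\|_{H^{1,h}(\Omega^h)}\le\delta .$$ Let $\widetilde{\mathbf U}^{*,h}$, with $\mathbf U^{*,h}\in H^{1,h}(\Omega^h)$, be the exact solution of $$\mathbf U^{*,h}_y+D^h\mathbf U^{*,h}_x=\mathbf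 0\ \text{ in }\Omega^h,\quad \mathbf U^{*,h}(a)=\mathbf 0,\ \mathbf U^{*,h}(b)=\mathbf g^{*,h}(b),\ \mathbf U^{*,h}_0(y)=\mathbf g^*(-R,y),\ \mathbf U^{*,h}_K(y)=\mathbf g^*(R,y).$$ Let $\widetilde{\mathbf U}^h_\delta$ be the (unique) minimizer of $$J^h_\varepsilon(\widetilde{\mathbf U}^h)=\|\mathbf U^h_y+D^h\mathbf U^h_x\|^2_{L^{2,h}(\Omega^h)}+\varepsilon\|\mathbf U^h\|^2_{H^{1,h}(\Omega^h)}$$ over all $\widetilde{\mathbf U}^h$ with $\mathbf U^h\in H^{1,h}(\Omega^h)$, $\mathbf U^h(a)=\mathbf 0$, $\mathbf U^h(b)=\mathbf g^h_\delta(b)$, $\mathbf U^h_0(y)=\mathbf g_\delta(-R,y)$, $\mathbf U^h_K(y)=\mathbf g_\delta(R,y)$. Then $$\|\mathbf U^h_\delta-\mathbf U^{*,h}\|_{H^{1,h}(\Omega^h)}\le C_{h_0}\left(\delta+\sqrt{\varepsilon}\,\|\mathbf U^{*,h}\|_{H^{1,h}(\Omega^h)}\right).$$ In particular, choosing $\varepsilon\in[0,\delta^2]$, one obtains $$\|\mathbf U^h_\delta-\mathbf U^{*,h}\|_{H^{1,h}(\Omega^h)}\le C_{h_0}\delta .$$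
   Context: All functions are real valued. **Basis and matrices.** $\{\Psi_n\}_{n\ge1}$ is the orthonormal basis of $L^2(-d,d)$ obtained by applying Gram–Schmidt orthonormalization to the functions $\alpha^{n-1}e^{\alpha}$, $n=1,2,\dots$. $M_N$ is the $N\times N$ matrix with $(m,n)$ entry $\int_{-d}^d\Psi_n'(\alpha)\Psi_m(\alpha)\,d\alpha$; it is upper triangular with unit diagonal, hence invertible. For $\mathbf x=(x,y)\in\overline\Omega$ let $|\mathbf x-\mathbf x_\alpha|^2=(x-\alpha)^2+y^2$, and let $D_1(\mathbf x),D_2(\mathbf x)$ be the $N\times N$ matrices with entries $$(D_1)_{mn}=-\int_{-d}^d\frac{x-\alpha}{|\mathbf x-\mathbf x_\alpha|^2}\Psi_m(\alpha)\Psi_n(\alpha)\,d\alpha,$$ $$(D_2)_{mn}=\int_{-d}^d\Big(-\frac{x-\alpha}{y}\Psi_m(\alpha)\Psi_n'(\alpha)+\frac{y}{|\mathbf x-\mathbf x_\alpha|^2}\Psi_m(\alpha)\Psi_n(\alpha)\Big)d\alpha .$$ The norm of a matrix is the square root of the sum of squares of its entries. The number $a_0=a_0(N,R,d)>1$ is fixed so that for all $b>a\ge a_0$ the matrix $M_N(I-M_N^{-1}D_1(\mathbf x))$ is invertible for all $\mathbf x\in\overline\Omega$ and $D(\mathbf x)=-[M_N(I-M_N^{-1}D_1(\mathbf x))]^{-1}D_2(\mathbf x)$ satisfies $\max_{\overline\Omega}\|D\|\le C_1$ with $C_1$ depending only on $N,R,d$ (such a number exists). **Semi-discretization.** For $h$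 with $K=2R/h$ an integer put $x_i=-R+ih$, $i=0,\dots,K$, and $\Omega^h=\{(x_i,y):i=1,\dots,K-1,\ y\in(a,b)\}$. A tuple of $\mathbb R^N$-valued functions of $y\in[a,b]$ indexed by all grid indices is written $\widetilde{\mathbf Q}^h=(\mathbf Q^h_0,\dots,\mathbf Q^h_K)^T$, and its part with interior indices is $\mathbf Q^h=(\mathbf Q^h_1,\dots,\mathbf Q^h_{K-1})^T$; $\mathbf Q^h_i$ represents the values at $x=x_i$. Set $\mathbf Q^h_{jx}(y)=\dfrac{\mathbf Q^h_{j+1}(y)-\mathbf Q^h_{j-1}(y)}{2h}$ for $j=1,\dots,K-1$ (this uses the boundary components $\mathbf Q_0^h,\mathbf Q_K^h$), $\mathbf Q^h_x=(\mathbf Q^h_{1x},\dots,\mathbf Q^h_{(K-1)x})^T$ and $\mathbf Q^h_y=\partial_y\mathbf Q^h$. $D^h(y)$ is the block diagonal matrix with blocks $D(x_1,y),\dots,D(x_{K-1},y)$, so the $j$-th component of $D^h\mathbf Q^h_x$ is $D(x_j,y)\mathbf Q^h_{jx}(y)$. For $\mathbf g$ on $\partial\Omega$, $\mathbf g^h(b)=(\mathbf g(x_1,b),\dots,\mathbf g(x_{K-1},b))^T$. **Norms.** $$\|\mathbf U^h\|^2_{L^{2,h}(\Omega^h)}=\sum_{i=1}^{K-1}h\int_a^b|\mathbf U^h_i(y)|^2dy,$$ $$\|\mathbf U^h\|^2_{H^{1,h}(\Omega^h)}=\sum_{j=1}^{K-1}h\int_a^b\big(|\mathbf U^h_{jx}(y)|^2+|\partial_y\mathbf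 U^h_j(y)|^2+|\mathbf U^h_j(y)|^2\big)dy,$$ where $|\cdot|$ is the Euclidean norm on $\mathbb R^N$; $L^{2,h}(\Omega^h)$ and $H^{1,h}(\Omega^h)$ consist of those $\mathbf U^h$ for which the respective quantity is finite (for $H^{1,h}$ the components are weakly differentiable in $y$).
   Formalization: The last estimate, for ε in [0,δ²], is stated with bound C_{h_0}(1+‖U*‖)δ instead of C_{h_0}δ, norm of U* in H^{1,h}: with a constant depending only on N, Ω, d, h_0 it is false, since for fixed δ and ε=δ² the error can grow linearly with U*. *)

theory Defs
  imports "HOL-Analysis.Analysis"
begin

text \<open>
  The dimension \<open>N\<close> is the cardinality of a finite, linearly ordered index type \<open>'n\<close>. The norms of
  \<^typ>\<open>real ^ 'n\<close> and \<^typ>\<open>real ^ 'n ^ 'n\<close> are the Euclidean norm and the Frobenius norm.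
  The functions \<open>\<Psi>\<^sub>1, \<Psi>\<^sub>2, \<dots>\<close> are numbered from \<open>0\<close>: \<open>gs_basis d k\<close> is \<open>\<Psi>\<^sub>k\<^sub>+\<^sub>1\<close>.
\<close>

type_synonym 'n rvec = "(real, 'n) vec"
type_synonym 'n rmat = "((real, 'n) vec, 'n) vec"

definition L2_inner :: "real \<Rightarrow> (real \<Rightarrow> real) \<Rightarrow> (real \<Rightarrow> real) \<Rightarrow> real" where
  "L2_inner d f g = integral {-d..d} (\<lambda>\<alpha>. f \<alpha> * g \<alpha>)"

definition gs_source :: "nat \<Rightarrow> real \<Rightarrow> real" where
  "gs_source k \<alpha> = \<alpha> ^ k * exp \<alpha>"

fun gs_basis :: "real \<Rightarrow> nat \<Rightarrow> real \<Rightarrow> real" where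
  "gs_basis d k =
     (let u = (\<lambda>\<alpha>. gs_source k \<alpha>
                  - (\<Sum>j<k. L2_inner d (gs_source k) (gs_basis d j) * gs_basis d j \<alpha>))
      in (\<lambda>\<alpha>. u \<alpha> / sqrt (L2_inner d u u)))"

declare gs_basis.simps [simp del]

definition Psi :: "real \<Rightarrow> 'n::{finite,linorder} \<Rightarrow> real \<Rightarrow> real" where
  "Psi d n = gs_basis d (card {..<n})"

definition M_mat :: "real \<Rightarrow> ('n::{finite,linorder}) rmat" where
  "M_mat d = (\<chi> m n. integral {-d..d} (\<lambda>\<alpha>. deriv (Psi d n) \<alpha> * Psi d m \<alpha>))"

definition D1_mat :: "real \<Rightarrow> real \<Rightarrow> real \<Rightarrow> ('n::{finite,linorder}) rmat" where
  "D1_mat d x y = (\<chi> m n. - integral {-d..d}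
     (\<lambda>\<alpha>. (x - \<alpha>) / ((x - \<alpha>)\<^sup>2 + y\<^sup>2) * Psi d m \<alpha> * Psi d n \<alpha>))"

definition D2_mat :: "real \<Rightarrow> real \<Rightarrow> real \<Rightarrow> ('n::{finite,linorder}) rmat" where
  "D2_mat d x y = (\<chi> m n. integral {-d..d}
     (\<lambda>\<alpha>. - ((x - \<alpha>) / y) * Psi d m \<alpha> * deriv (Psi d n) \<alpha>
          + y / ((x - \<alpha>)\<^sup>2 + y\<^sup>2) * Psi d m \<alpha> * Psi d n \<alpha>))"

definition system_mat :: "real \<Rightarrow> real \<Rightarrow> real \<Rightarrow> ('n::{finite,linorder}) rmat" where
  "system_mat d x y = M_mat d ** (mat 1 - matrix_inv (M_mat d) ** D1_mat d x y)"

definition D_mat :: "real \<Rightarrow> real \<Rightarrow> real \<Rightarrow> ('n::{finite,linorder}) rmat" where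
  "D_mat d x y = - (matrix_inv (system_mat d x y) ** D2_mat d x y)"

text \<open>The type argument carries the dimension \<open>N\<close>.\<close>

definition admissible_a0 :: "'n::{finite,linorder} itself \<Rightarrow> real \<Rightarrow> real \<Rightarrow> real \<Rightarrow> bool" where
  "admissible_a0 _ R d a0 \<longleftrightarrow> 1 < a0 \<and>
     (\<exists>C1. \<forall>a b. a0 \<le> a \<and> a < b \<longrightarrow>
        (\<forall>x\<in>{-R..R}. \<forall>y\<in>{a..b}.
           invertible (system_mat d x y :: 'n rmat) \<and>
           norm (D_mat d x y :: 'n rmat) \<le> C1))"

definition C1_on :: "real \<Rightarrow> real \<Rightarrow> (real \<Rightarrow> 'v::real_normed_vector) \<Rightarrow> bool" where
  "C1_on a b f \<longleftrightarrow> (\<exists>f'. continuous_on {a..b} f' \<and>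
     (\<forall>y\<in>{a..b}. (f has_vector_derivative f' y) (at y within {a..b})))"

definition L2_on :: "real \<Rightarrow> real \<Rightarrow> (real \<Rightarrow> 'v::euclidean_space) \<Rightarrow> bool" where
  "L2_on a b u \<longleftrightarrow> u \<in> borel_measurable (lebesgue_on {a..b}) \<and>
     integrable (lebesgue_on {a..b}) (\<lambda>y. (norm (u y))\<^sup>2)"

text \<open>
  Square-integrable weak derivatives on \<open>(a,b)\<close>. As is usual for Sobolev spaces on an interval,
  the test functions \<open>\<phi>\<close> range over \<open>C\<^sup>1\<close> functions with compact support in \<open>(a,b)\<close>;
  \<open>\<phi>'\<close> is the derivative of \<open>\<phi>\<close>.
\<close>

definition weak_deriv_L2 ::
    "real \<Rightarrow> real \<Rightarrow> (real \<Rightarrow> 'v::euclidean_space) \<Rightarrow> (real \<Rightarrow> 'v) \<Rightarrow> bool" where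
  "weak_deriv_L2 a b u v \<longleftrightarrow> L2_on a b v \<and>
     (\<forall>\<phi> \<phi>' :: real \<Rightarrow> real.
        (\<forall>y. (\<phi> has_real_derivative \<phi>' y) (at y)) \<and> continuous_on UNIV \<phi>' \<and>
        (\<exists>c e. a < c \<and> e < b \<and> (\<forall>y. y \<notin> {c..e} \<longrightarrow> \<phi> y = 0)) \<longrightarrow>
        (LINT y|lebesgue_on {a..b}. \<phi>' y *\<^sub>R u y)
          = - (LINT y|lebesgue_on {a..b}. \<phi> y *\<^sub>R v y))"

text \<open>
  A tuple \<open>(Q\<^sub>0, \<dots>, Q\<^sub>K)\<close> of functions on \<open>[a,b]\<close> is a function \<^typ>\<open>nat \<Rightarrow> real \<Rightarrow> real ^ 'n\<close>;
  only the indices \<open>0, \<dots>, K\<close> and the arguments in \<open>[a,b]\<close> matter. The interior indices are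
  \<open>{1..<K}\<close>, and \<open>grid_dx\<close> is only used there.
\<close>

definition grid_pt :: "real \<Rightarrow> real \<Rightarrow> nat \<Rightarrow> real" where
  "grid_pt R h i = - R + real i * h"

definition grid_dx :: "real \<Rightarrow> (nat \<Rightarrow> real \<Rightarrow> ('n::finite) rvec) \<Rightarrow> nat \<Rightarrow> real \<Rightarrow> 'n rvec" where
  "grid_dx h Q j y = (1 / (2 * h)) *\<^sub>R (Q (j + 1) y - Q (j - 1) y)"

text \<open>Weak derivatives are unique up to null sets, so the choice below affects no norm or integral.\<close>

definition grid_dy :: "real \<Rightarrow> real \<Rightarrow> (nat \<Rightarrow> real \<Rightarrow> ('n::finite) rvec) \<Rightarrow> nat \<Rightarrow> real \<Rightarrow> 'n rvec" where
  "grid_dy a b Q j = (SOME v. weak_deriv_L2 a b (Q j) v)"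

text \<open>
  Every weakly differentiable function with square-integrable derivative on a bounded interval
  has a unique continuous representative on \<open>[a,b]\<close>. Elements of \<open>H\<^sup>1\<^sup>,\<^sup>h\<close> are
  taken to be given by these representatives, so that their values at \<open>a\<close> and \<open>b\<close> are
  the traces.
\<close>

definition H1h :: "real \<Rightarrow> real \<Rightarrow> nat \<Rightarrow> real \<Rightarrow> (nat \<Rightarrow> real \<Rightarrow> ('n::finite) rvec) set" where
  "H1h a b K h = {U. \<forall>j\<in>{1..<K}.
     continuous_on {a..b} (U j) \<and> (\<exists>v. weak_deriv_L2 a b (U j) v) \<and>
     L2_on a b (U j) \<and> L2_on a b (grid_dx h U j)}"

definition L2h_norm :: "real \<Rightarrow> real \<Rightarrow> nat \<Rightarrow> real \<Rightarrow> (nat \<Rightarrow> real \<Rightarrow> ('n::finite) rvec) \<Rightarrow> real" where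
  "L2h_norm a b K h U =
     sqrt (\<Sum>j\<in>{1..<K}. h * (LINT y|lebesgue_on {a..b}. (norm (U j y))\<^sup>2))"

definition H1h_norm :: "real \<Rightarrow> real \<Rightarrow> nat \<Rightarrow> real \<Rightarrow> (nat \<Rightarrow> real \<Rightarrow> ('n::finite) rvec) \<Rightarrow> real" where
  "H1h_norm a b K h U =
     sqrt (\<Sum>j\<in>{1..<K}. h * (LINT y|lebesgue_on {a..b}.
       (norm (grid_dx h U j y))\<^sup>2 + (norm (grid_dy a b U j y))\<^sup>2 + (norm (U j y))\<^sup>2))"

definition grid_op :: "real \<Rightarrow> real \<Rightarrow> real \<Rightarrow> real \<Rightarrow> real \<Rightarrow>
    (nat \<Rightarrow> real \<Rightarrow> ('n::{finite,linorder}) rvec) \<Rightarrow> nat \<Rightarrow> real \<Rightarrow> 'n rvec" where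
  "grid_op d R a b h U j y =
     grid_dy a b U j y + D_mat d (grid_pt R h j) y *v grid_dx h U j y"

definition functional_J :: "real \<Rightarrow> real \<Rightarrow> real \<Rightarrow> real \<Rightarrow> nat \<Rightarrow> real \<Rightarrow> real \<Rightarrow>
    (nat \<Rightarrow> real \<Rightarrow> ('n::{finite,linorder}) rvec) \<Rightarrow> real" where
  "functional_J d R a b K h \<epsilon> U =
     (L2h_norm a b K h (grid_op d R a b h U))\<^sup>2 + \<epsilon> * (H1h_norm a b K h U)\<^sup>2"

text \<open>Boundary data are functions of which only the values on the boundary of the rectangle matter.\<close>

definition boundary_data :: "real \<Rightarrow> real \<Rightarrow> real \<Rightarrow> (real \<times> real \<Rightarrow> ('n::finite) rvec) \<Rightarrow> bool" where
  "boundary_data R a b g \<longleftrightarrow> (\<forall>x\<in>{-R..R}. g (x, a) = 0) \<and>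
     C1_on a b (\<lambda>y. g (- R, y)) \<and> C1_on a b (\<lambda>y. g (R, y))"

definition matches_data :: "real \<Rightarrow> real \<Rightarrow> real \<Rightarrow> nat \<Rightarrow> real \<Rightarrow>
    (real \<times> real \<Rightarrow> ('n::finite) rvec) \<Rightarrow> (nat \<Rightarrow> real \<Rightarrow> 'n rvec) \<Rightarrow> bool" where
  "matches_data R a b K h g U \<longleftrightarrow>
     (\<forall>j\<in>{1..<K}. U j a = 0 \<and> U j b = g (grid_pt R h j, b)) \<and>
     (\<forall>y\<in>{a..b}. U 0 y = g (- R, y) \<and> U K y = g (R, y))"

definition exact_solution :: "real \<Rightarrow> real \<Rightarrow> real \<Rightarrow> real \<Rightarrow> nat \<Rightarrow> real \<Rightarrow>
    (real \<times> real \<Rightarrow> 'n rvec) \<Rightarrow> (nat \<Rightarrow> real \<Rightarrow> ('n::{finite,linorder}) rvec) \<Rightarrow> bool" where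
  "exact_solution d R a b K h g U \<longleftrightarrow> U \<in> H1h a b K h \<and> matches_data R a b K h g U \<and>
     (\<forall>j\<in>{1..<K}. AE y in lebesgue_on {a..b}. grid_op d R a b h U j y = 0)"

end

theory Submission
  imports Defs
begin

text \<open>
  Write \<open>L\<close> for the semi-discrete operator and \<open>G = F\<^sub>\<delta> - F\<^sup>*\<close>. Comparing the minimizer with the
  competitor \<open>U\<^sup>* + G\<close> bounds \<open>L U\<^sub>\<delta>\<close> in \<open>L\<^sup>2\<close> by \<open>\<delta> + \<surd>\<epsilon> \<parallel>U\<^sup>*\<parallel>\<close>, since \<open>L U\<^sup>* = 0\<close>; no
  Euler-Lagrange equation is needed. The function \<open>W = U\<^sub>\<delta> - U\<^sup>* - G\<close> vanishes at \<open>y = a\<close> and on the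
  lateral sides. As \<open>h \<ge> h\<^sub>0\<close>, its difference quotient in \<open>x\<close> is bounded by \<open>|W| / h\<^sub>0\<close>, so that
  \<open>W\<^sub>y = L W - D W\<^sub>x\<close> is a linear ordinary differential equation with bounded coefficients, and
  Gronwall's inequality yields \<open>\<parallel>W\<parallel> \<le> c \<parallel>L W\<parallel>\<close>.
\<close>

section \<open>Continuity of the coefficient matrix\<close>

text \<open>Two obstacles shape the proof. Weak derivatives are picked by a choice operator, so
  \<open>grid_dy\<close> is linear only up to null sets, and the residual of a sum can be split only
  under integrals; this rests on uniqueness of weak derivatives. Gronwall, in turn, acts on
  pointwise values, so a weak derivative must be integrated back to the continuous representative,
  starting at the endpoint y = a where the initial value is posed. Both needs are met by the
  identity u x - u a = integral of v over [a,x], obtained by testing with C^1 approximations of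
  indicator functions.

  The bound on D alone does not make D W_x measurable; continuity of D in y does. One constant must
  serve every admissible mesh, so the number of grid lines enters only through K <= 2R/h0, and the
  weight h occurs alike on both sides of the stability estimate. Norms are kept squared throughout,
  which replaces triangle inequalities by |x + c y|^2 <= 2|x|^2 + 2c^2|y|^2 and costs only numerical
  factors.\<close>

lemma continuous_on_det:
  fixes A :: "'a::topological_space \<Rightarrow> real^'n^'n"
  assumes "\<And>i j. continuous_on S (\<lambda>x. A x $ i $ j)"
  shows "continuous_on S (\<lambda>x. det (A x))"
  unfolding det_def by (intro continuous_intros assms)

lemma continuous_on_matrix_matrix_mult:
  fixes A :: "'a::topological_space \<Rightarrow> real^'n^'m" and B :: "'a \<Rightarrow> real^'p^'n"
  assumes "continuous_on S A" "continuous_on S B"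
  shows "continuous_on S (\<lambda>x. A x ** B x)"
  unfolding matrix_matrix_mult_def by (intro continuous_intros assms)

lemma matrix_inv_mult:
  assumes "invertible A"
  shows "A ** matrix_inv A = mat 1" "matrix_inv A ** A = mat 1"
  using assms someI_ex[of "\<lambda>B. A ** B = mat 1 \<and> B ** A = mat 1"]
  unfolding invertible_def matrix_inv_def by blast+

text \<open>Column l of the inverse solves A x = e_l, so Cramer's rule applies. The formula makes
  each entry a quotient of polynomials in the entries of A, which is how continuity passes to the
  inverse.\<close>

lemma matrix_inv_cramer:
  fixes A :: "real^'n^'n"
  assumes "invertible A"
  shows "matrix_inv A $ k $ l
    = det (\<chi> i j. if j = k then (if i = l then 1 else 0) else A $ i $ j) / det A"
proof -
  have "A *v column l (matrix_inv A) = axis l 1"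
    using matrix_inv_mult(1)[OF assms]
    by (auto simp: vec_eq_iff matrix_matrix_mult_def matrix_vector_mult_def column_def mat_def axis_def)
  then have "column l (matrix_inv A)
    = (\<chi> k. det (\<chi> i j. if j = k then axis l 1 $ i else A $ i $ j) / det A)"
    using cramer[of A "column l (matrix_inv A)" "axis l 1"] assms by (simp add: invertible_det_nz)
  then have "column l (matrix_inv A) $ k
    = det (\<chi> i j. if j = k then axis l 1 $ i else A $ i $ j) / det A"
    by simp
  then show ?thesis
    by (simp add: column_def axis_def cong: if_cong)
qed

lemma continuous_on_matrix_inv:
  fixes A :: "'a::topological_space \<Rightarrow> real^'n^'n"
  assumes A: "continuous_on S A" and inv: "\<And>x. x \<in> S \<Longrightarrow> invertible (A x)"
  shows "continuous_on S (\<lambda>x. matrix_inv (A x))"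
proof -
  have ent: "continuous_on S (\<lambda>x. A x $ i $ j)" for i j
    by (intro continuous_intros A)
  have "continuous_on S (\<lambda>x. matrix_inv (A x) $ k $ l)" for k l
  proof -
    have "continuous_on S (\<lambda>x. det (\<chi> i j. if j = k then (if i = l then 1 else 0) else A x $ i $ j) / det (A x))"
    proof (intro continuous_on_divide continuous_on_det ballI)
      show "continuous_on S (\<lambda>x. (\<chi> i j. if j = k then (if i = l then 1 else 0) else A x $ i $ j) $ i $ j)" for i j
        by (cases "j = k") (auto intro: ent)
    qed (use inv in \<open>auto intro: ent simp: invertible_det_nz\<close>)
    then show ?thesis
      by (rule continuous_on_eq) (simp add: matrix_inv_cramer inv)
  qed
  then have "continuous_on S (\<lambda>x. \<chi> k l. matrix_inv (A x) $ k $ l)"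
    by (intro continuous_on_vec_lambda)
  then show ?thesis by simp
qed

text \<open>The Frobenius norm is the Euclidean norm of the row norms, so Cauchy-Schwarz in each row
  suffices.\<close>

lemma norm_matrix_vector_mult_le:
  fixes A :: "real^'n^'m"
  shows "norm (A *v x) \<le> norm A * norm x"
proof -
  have "norm (A *v x) = L2_set (\<lambda>i. \<bar>inner (A $ i) x\<bar>) UNIV"
    by (simp add: norm_vec_def matrix_vector_mult_def inner_vec_def)
  also have "\<dots> \<le> L2_set (\<lambda>i. norm (A $ i) * norm x) UNIV"
    by (intro L2_set_mono) (auto simp: Cauchy_Schwarz_ineq2)
  also have "\<dots> = norm A * norm x"
    by (simp add: norm_vec_def[of A] L2_set_left_distrib)
  finally show ?thesis .
qed

section \<open>Smoothness of the Gram-Schmidt basis and of the coefficients\<close>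

lemma gs_source_C1: 
  "\<exists>f'. continuous_on UNIV f' \<and> (\<forall>x. (gs_source k has_real_derivative f' x) (at x))"
proof (intro exI conjI allI)
  show "continuous_on UNIV (\<lambda>\<alpha>::real. real k * \<alpha> ^ (k - 1) * exp \<alpha> + \<alpha> ^ k * exp \<alpha>)"
    by (intro continuous_intros)
  show "(gs_source k has_real_derivative (real k * x ^ (k - 1) * exp x + x ^ k * exp x)) (at x)" for x
    unfolding gs_source_def[abs_def] by (auto intro!: derivative_eq_intros)
qed

text \<open>Strong induction along Gram-Schmidt. Normalization multiplies by the constant
  \<open>inverse (sqrt (L2_inner d u u))\<close>; total division makes it 0 if the norm vanishes, so
  the derivative formula holds for every \<open>d\<close>.\<close>

lemma gs_basis_C1:
  "\<exists>f'. continuous_on UNIV f' \<and> (\<forall>x. (gs_basis d k has_real_derivative f' x) (at x))"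
proof (induction k rule: less_induct)
  case (less k)
  obtain s where s: "continuous_on UNIV s" "\<And>x. (gs_source k has_real_derivative s x) (at x)"
    using gs_source_C1 by blast
  obtain f where f: "\<And>j. j < k \<Longrightarrow> continuous_on UNIV (f j)"
    "\<And>j x. j < k \<Longrightarrow> (gs_basis d j has_real_derivative f j x) (at x)"
    using less by metis
  define c where "c j = L2_inner d (gs_source k) (gs_basis d j)" for j
  define u where "u \<alpha> = gs_source k \<alpha> - (\<Sum>j<k. c j * gs_basis d j \<alpha>)" for \<alpha>
  have eq: "gs_basis d k = (\<lambda>\<alpha>. u \<alpha> / sqrt (L2_inner d u u))"
    by (subst gs_basis.simps) (simp add: Let_def u_def[abs_def] c_def)
  show ?case
  proof (intro exI conjI allI)
    show "continuous_on UNIV (\<lambda>x. (s x - (\<Sum>j<k. c j * f j x)) * inverse (sqrt (L2_inner d u u)))"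
      by (intro continuous_intros s f) auto
    show "(gs_basis d k has_real_derivative
        (s x - (\<Sum>j<k. c j * f j x)) * inverse (sqrt (L2_inner d u u))) (at x)" for x
      unfolding eq divide_inverse u_def[abs_def]
      by (intro DERIV_cmult_right DERIV_diff DERIV_sum DERIV_cmult s f) auto
  qed
qed

lemma Psi_continuous: "continuous_on S (Psi d n)" "continuous_on S (deriv (Psi d n))"
proof -
  obtain f' where f': "continuous_on UNIV f'" "\<And>x. (Psi d n has_real_derivative f' x) (at x)"
    unfolding Psi_def using gs_basis_C1 by blast
  then have "deriv (Psi d n) = f'"
    using DERIV_imp_deriv by blast
  with f' show "continuous_on S (deriv (Psi d n))"
    using continuous_on_subset by blast
  show "continuous_on S (Psi d n)"
    using f'(2) DERIV_isCont continuous_at_imp_continuous_on by blast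
qed

text \<open>Only y varies, since a block of the system lives on one grid line. As y >= a > 0, the
  integrands are jointly continuous in y and the integration variable, hence so are the parameter
  integrals in y; the inverse follows by Cramer's formula.\<close>

lemma D_mat_continuous:
  assumes a: "0 < a" and inv: "\<And>y. y \<in> {a..b} \<Longrightarrow> invertible (system_mat d x y :: ('n::{finite,linorder}) rmat)"
  shows "continuous_on {a..b} (\<lambda>y. D_mat d x y :: 'n rmat)"
proof -
  have Psi: "continuous_on S (\<lambda>z. Psi d n (snd z))" "continuous_on S (\<lambda>z. deriv (Psi d n) (snd z))"
    for S :: "(real \<times> real) set" and n :: 'n
    by (rule continuous_on_compose2[OF Psi_continuous(1)[of UNIV]]
             continuous_on_compose2[OF Psi_continuous(2)[of UNIV]]; auto intro: continuous_intros)+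
  have nz: "(x - \<alpha>)\<^sup>2 + y\<^sup>2 \<noteq> 0" if "a \<le> y" for y \<alpha>
    using that a by (auto simp: add_nonneg_eq_0_iff)
  have "continuous_on {a..b} (\<lambda>y. D1_mat d x y :: 'n rmat)"
    unfolding D1_mat_def cbox_interval[symmetric]
    using a by (intro continuous_intros integral_continuous_on_param)
       (auto simp: case_prod_unfold nz intro!: continuous_intros Psi)
  moreover have D2: "continuous_on {a..b} (\<lambda>y. D2_mat d x y :: 'n rmat)"
    unfolding D2_mat_def cbox_interval[symmetric]
    using a by (intro continuous_intros integral_continuous_on_param)
       (auto simp: case_prod_unfold nz intro!: continuous_intros Psi)
  ultimately have "continuous_on {a..b} (\<lambda>y. system_mat d x y :: 'n rmat)"
    unfolding system_mat_def by (intro continuous_intros continuous_on_matrix_matrix_mult)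
  then show ?thesis
    unfolding D_mat_def
    by (intro continuous_intros continuous_on_matrix_matrix_mult continuous_on_matrix_inv inv D2)
qed

section \<open>Weak derivatives on an interval\<close>

text \<open>Up to rescaling, the test functions that recover \<open>u y - u x\<close> from the weak derivative of \<open>u\<close>.\<close>

definition smooth_step :: "real \<Rightarrow> real" where
  "smooth_step t = ((max 0 t)\<^sup>2 - 2 * (max 0 (t - 1))\<^sup>2 + (max 0 (t - 2))\<^sup>2) / 2"

definition hat :: "real \<Rightarrow> real" where
  "hat t = max 0 t - 2 * max 0 (t - 1) + max 0 (t - 2)"

text \<open>Away from 0 the function is locally 0 or t^2; at 0 the difference quotient is bounded by
  |h|. Squaring the positive part turns its kink into the C^1 join that test functions
  require.\<close>

lemma has_real_derivative_max_0_square: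
  "((\<lambda>t. (max 0 t)\<^sup>2) has_real_derivative 2 * max 0 t) (at t)" for t :: real
proof -
  consider "t < 0" | "t = 0" | "t > 0" by linarith
  then show ?thesis
  proof cases
    case 1
    have "((\<lambda>t::real. 0) has_real_derivative 0) (at t)" by simp
    then have "((\<lambda>t. (max 0 t)\<^sup>2) has_real_derivative 0) (at t)"
      by (rule has_field_derivative_transform_within_open[where S = "{..<0}"]) (use 1 in auto)
    then show ?thesis using 1 by simp
  next
    case 2
    have "(\<lambda>h::real. \<bar>h\<bar>) \<midarrow>0\<rightarrow> 0" by (rule tendsto_eq_intros refl tendsto_ident_at | simp)+
    then have "(\<lambda>h::real. ((max 0 (0 + h))\<^sup>2 - (max 0 0)\<^sup>2) / h) \<midarrow>0\<rightarrow> 0"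
      by (rule Lim_null_comparison[rotated])
         (auto simp: eventually_at_filter max_def power2_eq_square)
    then show ?thesis using 2 by (simp add: DERIV_def)
  next
    case 3
    have "((\<lambda>t. t\<^sup>2) has_real_derivative 2 * t) (at t)" by (auto intro!: derivative_eq_intros)
    then have "((\<lambda>t. (max 0 t)\<^sup>2) has_real_derivative 2 * t) (at t)"
      by (rule has_field_derivative_transform_within_open[where S = "{0<..}"]) (use 3 in auto)
    then show ?thesis using 3 by simp
  qed
qed

text \<open>\<open>hat\<close> is the second difference with unit step of the positive part, the
  linear B-spline on [0,2]; \<open>smooth_step\<close> is the same second difference of its
  antiderivative, half the squared positive part.\<close>

lemma smooth_step_deriv: "(smooth_step has_real_derivative hat t) (at t)"
proof -
  have "((\<lambda>t. (max 0 (t - c))\<^sup>2) has_real_derivative 2 * max 0 (t - c) * 1) (at t)" for c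
    by (rule DERIV_chain2[OF has_real_derivative_max_0_square]) (auto intro!: derivative_eq_intros)
  note d = this
  have "(smooth_step has_real_derivative
      (2 * max 0 t - 2 * (2 * max 0 (t - 1) * 1) + 2 * max 0 (t - 2) * 1) / 2) (at t)"
    unfolding smooth_step_def[abs_def]
    by (intro DERIV_cdivide DERIV_add DERIV_diff DERIV_cmult d has_real_derivative_max_0_square)
  then show ?thesis by (simp add: hat_def add_divide_distrib diff_divide_distrib)
qed

lemma continuous_hat: "continuous_on S hat"
  unfolding hat_def[abs_def] by (intro continuous_intros)

lemma hat_nonneg: "0 \<le> hat t"
  by (auto simp: hat_def max_def)

lemma hat_eq_0: "t \<notin> {0..2} \<Longrightarrow> hat t = 0"
  by (auto simp: hat_def max_def)

lemma smooth_step_eq_0: "t \<le> 0 \<Longrightarrow> smooth_step t = 0"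
  by (auto simp: smooth_step_def max_def)

lemma smooth_step_eq_1: "2 \<le> t \<Longrightarrow> smooth_step t = 1"
  by (auto simp: smooth_step_def max_def power2_eq_square field_simps)

lemma smooth_step_mono: "s \<le> t \<Longrightarrow> smooth_step s \<le> smooth_step t"
  using DERIV_nonneg_imp_nondecreasing smooth_step_deriv hat_nonneg by metis

lemma smooth_step_bounds: "0 \<le> smooth_step t" "smooth_step t \<le> 1"
  using smooth_step_mono[of "min 0 t" t] smooth_step_mono[of t "max 2 t"]
  by (auto simp: smooth_step_eq_0 smooth_step_eq_1)

lemma scaled_step_deriv:
  "((\<lambda>t. smooth_step (c * (t - x))) has_real_derivative c * hat (c * (t - x))) (at t)"
proof -
  have "((\<lambda>t. smooth_step (c * (t - x))) has_real_derivative hat (c * (t - x)) * c) (at t)"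
    by (rule DERIV_chain2[OF smooth_step_deriv]) (auto intro!: derivative_eq_intros)
  then show ?thesis by (simp add: mult.commute)
qed

text \<open>An approximate identity: the kernel is nonnegative, lives on [x, x + 2/n] and has mass 1
  for large n. It sits to the right of x, so x = a is allowed while some room before b is
  required.\<close>

lemma scaled_hat_average:
  fixes u :: "real \<Rightarrow> 'v::euclidean_space"
  assumes u: "continuous_on {a..b} u" and x: "a \<le> x" "x < b"
  shows "(\<lambda>n. LINT t|lebesgue_on {a..b}. (real n * hat (real n * (t - x))) *\<^sub>R u t) \<longlonglongrightarrow> u x"
proof (rule LIMSEQ_I)
  fix r :: real assume r: "0 < r"
  obtain e where e: "e > 0" "\<And>t. t \<in> {a..b} \<Longrightarrow> dist t x < e \<Longrightarrow> dist (u t) (u x) < r / 2"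
    using u x r unfolding continuous_on_iff
    by (metis atLeastAtMost_iff half_gt_zero less_eq_real_def)
  \<comment> \<open>From here on the support, of length 2/n, stays within the continuity window of
    width e and before b, so no mass is cut off.\<close>
  obtain n0 :: nat where n0: "real n0 > 2 / min e (b - x)" using reals_Archimedean2 by blast
  show "\<exists>n0. \<forall>n\<ge>n0. norm ((LINT t|lebesgue_on {a..b}. (real n * hat (real n * (t - x))) *\<^sub>R u t) - u x) < r"
  proof (intro exI allI impI)
    fix n assume "n0 \<le> n"
    then have n: "real n > 2 / min e (b - x)" using n0 by (meson less_le_trans of_nat_le_iff)
    have "0 < 2 / min e (b - x)" using e x by simp
    then have npos: "real n > 0" using n by linarith
    have ne: "2 / real n < min e (b - x)"
      using n npos e x by (simp add: field_simps del: min_less_iff_conj)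
    let ?p = "\<lambda>t. real n * hat (real n * (t - x))"
    have contp: "continuous_on {a..b} ?p"
      by (intro continuous_intros continuous_on_compose2[OF continuous_hat[of UNIV]]) auto
    have "(?p has_integral smooth_step (real n * (b - x)) - smooth_step (real n * (a - x))) {a..b}"
      using x by (intro fundamental_theorem_of_calculus)
        (auto simp: has_real_derivative_iff_has_vector_derivative[symmetric]
          intro: has_field_derivative_at_within scaled_step_deriv)
    moreover have "smooth_step (real n * (b - x)) = 1"
      using ne npos by (intro smooth_step_eq_1) (auto simp: field_simps)
    moreover have "smooth_step (real n * (a - x)) = 0"
      using x by (intro smooth_step_eq_0) (auto simp: mult_nonneg_nonpos)
    ultimately have p1: "(?p has_integral 1) {a..b}" by simp
    have "(LINT t|lebesgue_on {a..b}. ?p t) = integral {a..b} ?p"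
      by (intro lebesgue_integral_eq_integral continuous_imp_integrable_real contp) auto
    also have "\<dots> = 1" using p1 by (rule integral_unique)
    finally have one: "(LINT t|lebesgue_on {a..b}. ?p t) = 1" .
    have int: "integrable (lebesgue_on {a..b}) (\<lambda>t. ?p t *\<^sub>R u t)"
         "integrable (lebesgue_on {a..b}) (\<lambda>t. ?p t *\<^sub>R u x)"
         "integrable (lebesgue_on {a..b}) ?p"
      by (intro continuous_imp_integrable_real continuous_intros contp u)+
    \<comment> \<open>Mass one writes the constant \<open>u x\<close> as its own average, leaving
      only the oscillation of u on the support.\<close>
    have "(LINT t|lebesgue_on {a..b}. ?p t *\<^sub>R u t) - u x
      = (LINT t|lebesgue_on {a..b}. ?p t *\<^sub>R u t) - (LINT t|lebesgue_on {a..b}. ?p t *\<^sub>R u x)"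
      using integral_scaleR_left[of "u x" "lebesgue_on {a..b}" ?p] int(3) one by simp
    also have "\<dots> = (LINT t|lebesgue_on {a..b}. ?p t *\<^sub>R u t - ?p t *\<^sub>R u x)"
      using int by (simp del: scaleR_scaleR)
    also have "norm \<dots> \<le> (LINT t|lebesgue_on {a..b}. ?p t * (r / 2))"
    proof (rule Bochner_Integration.integral_norm_bound_integral)
      show "integrable (lebesgue_on {a..b}) (\<lambda>t. ?p t * (r / 2))"
        by (rule integrable_mult_left) (rule int)
      show "norm (?p t *\<^sub>R u t - ?p t *\<^sub>R u x) \<le> ?p t * (r / 2)"
        if "t \<in> space (lebesgue_on {a..b})" for t
      proof (cases "real n * (t - x) \<in> {0..2}")
        case True
        then have "0 \<le> t - x" "t - x \<le> 2 / real n"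
          using npos by (auto simp: field_simps zero_le_mult_iff)
        then have "dist t x < e" using ne by (simp add: dist_real_def)
        then have "norm (u t - u x) \<le> r / 2" using e that by (fastforce simp: dist_norm)
        moreover have "?p t *\<^sub>R u t - ?p t *\<^sub>R u x = ?p t *\<^sub>R (u t - u x)"
          by (simp add: scaleR_right_diff_distrib)
        moreover have p0: "0 \<le> ?p t" using hat_nonneg by simp
        ultimately show ?thesis
          using mult_left_mono[OF _ p0, of "norm (u t - u x)" "r / 2"] by (simp add: abs_mult hat_nonneg)
      next
        case False then show ?thesis by (simp add: hat_eq_0)
      qed
    qed (use int in auto)
    also have "\<dots> = r / 2" using one by simp
    finally show "norm ((LINT t|lebesgue_on {a..b}. ?p t *\<^sub>R u t) - u x) < r" using r by linarith
  qed
qed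

text \<open>On a bounded interval constants are integrable, and s <= 1 + s^2 dominates.\<close>

lemma L2_on_integrable:
  assumes "L2_on a b u"
  shows "integrable (lebesgue_on {a..b}) u"
proof (rule Bochner_Integration.integrable_bound)
  show "integrable (lebesgue_on {a..b}) (\<lambda>y. 1 + (norm (u y))\<^sup>2)"
    using assms by (auto simp: L2_on_def intro!: Bochner_Integration.integrable_add
      continuous_imp_integrable_real)
  have "s \<le> 1 + s\<^sup>2" for s :: real
  proof -
    have "0 \<le> (s - 1 / 2)\<^sup>2" by simp
    also have "\<dots> = s\<^sup>2 - s + 1 / 4" by (simp add: power2_eq_square algebra_simps)
    finally show ?thesis by simp
  qed
  then show "AE y in lebesgue_on {a..b}. norm (u y) \<le> norm (1 + (norm (u y))\<^sup>2)"
    by (simp add: add_nonneg_nonneg)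
qed (use assms in \<open>auto simp: L2_on_def\<close>)

lemma LIMSEQ_scaled_smooth_step:
  "(\<lambda>n. smooth_step (real n * (t - x))) \<longlonglongrightarrow> (if x < t then 1 else 0)"
proof (cases "x < t")
  case True
  obtain n0 :: nat where n0: "real n0 > 2 / (t - x)" using reals_Archimedean2 by blast
  have "smooth_step (real n * (t - x)) = 1" if "n \<ge> n0" for n
  proof (rule smooth_step_eq_1)
    have "2 / (t - x) < real n" using n0 that by (meson less_le_trans of_nat_le_iff)
    then show "2 \<le> real n * (t - x)" using True by (simp add: field_simps)
  qed
  then have "\<forall>\<^sub>F n in sequentially. smooth_step (real n * (t - x)) = 1"
    using eventually_sequentially by blast
  with True show ?thesis by (simp add: tendsto_eventually)
next
  case False
  then have "real n * (t - x) \<le> 0" for n by (simp add: mult_nonneg_nonpos)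
  with False show ?thesis by (simp add: smooth_step_eq_0)
qed

text \<open>Test with the step at x minus the step at y. Its derivative is a difference of two
  averaging kernels, so the left side of the weak identity tends to u x - u y; the test function
  tends boundedly to the indicator of (x,y], so the right side tends to minus the integral of
  v.\<close>

lemma weak_deriv_L2_integral_interior:
  fixes u :: "real \<Rightarrow> 'v::euclidean_space"
  assumes w: "weak_deriv_L2 a b u v" and u: "continuous_on {a..b} u"
    and xy: "a < x" "x \<le> y" "y < b"
  shows "u y - u x = integral {x..y} v"
proof -
  let ?M = "lebesgue_on {a..b}"
  have v: "integrable ?M v" using w L2_on_integrable by (auto simp: weak_deriv_L2_def)
  define \<phi> where "\<phi> n t = smooth_step (real n * (t - x)) - smooth_step (real n * (t - y))" for n t
  define \<phi>' where "\<phi>' n t = real n * hat (real n * (t - x)) - real n * hat (real n * (t - y))" for n t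
  have conthat: "continuous_on S (\<lambda>t. real n * hat (real n * (t - x)))" for n x S
    by (intro continuous_intros continuous_on_compose2[OF continuous_hat[of UNIV]]) auto
  have der: "(\<phi> n has_real_derivative \<phi>' n t) (at t)" for n t
    unfolding \<phi>_def \<phi>'_def by (intro DERIV_diff scaled_step_deriv)
  have cont': "continuous_on S (\<phi>' n)" for n S
    unfolding \<phi>'_def by (intro continuous_on_diff conthat)
  have bd: "\<bar>\<phi> n t\<bar> \<le> 1" for n t
    using smooth_step_bounds[of "real n * (t - x)"] smooth_step_bounds[of "real n * (t - y)"]
    unfolding \<phi>_def by linarith
  have "(\<lambda>n. LINT t|?M. (real n * hat (real n * (t - x))) *\<^sub>R u t) \<longlonglongrightarrow> u x"
       "(\<lambda>n. LINT t|?M. (real n * hat (real n * (t - y))) *\<^sub>R u t) \<longlonglongrightarrow> u y"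
    by (rule scaled_hat_average[OF u]; use xy in simp)+
  then have "(\<lambda>n. (LINT t|?M. (real n * hat (real n * (t - x))) *\<^sub>R u t)
      - (LINT t|?M. (real n * hat (real n * (t - y))) *\<^sub>R u t)) \<longlonglongrightarrow> u x - u y"
    by (rule tendsto_diff)
  moreover have "(LINT t|?M. (real n * hat (real n * (t - x))) *\<^sub>R u t)
      - (LINT t|?M. (real n * hat (real n * (t - y))) *\<^sub>R u t) = (LINT t|?M. \<phi>' n t *\<^sub>R u t)" for n
    unfolding \<phi>'_def scaleR_left_diff_distrib
    by (rule Bochner_Integration.integral_diff[symmetric];
        intro continuous_imp_integrable_real continuous_on_scaleR conthat u)
  ultimately have lim1: "(\<lambda>n. LINT t|?M. \<phi>' n t *\<^sub>R u t) \<longlonglongrightarrow> u x - u y" by simp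
  let ?f = "\<lambda>t. if t \<in> {x<..y} then v t else 0"
  have "(\<lambda>n. LINT t|?M. \<phi> n t *\<^sub>R v t) \<longlonglongrightarrow> (LINT t|?M. ?f t)"
  proof (rule integral_dominated_convergence[where w = "\<lambda>t. norm (v t)"])
    have "(\<phi> n) \<in> borel_measurable ?M" for n
      using der by (intro continuous_imp_measurable_on_sets_lebesgue)
        (auto intro: DERIV_isCont continuous_at_imp_continuous_on)
    then show "(\<lambda>t. \<phi> n t *\<^sub>R v t) \<in> borel_measurable ?M" for n
      using v by (intro borel_measurable_scaleR) auto
    show "?f \<in> borel_measurable ?M"
      using v by (intro measurable_If_set) (auto simp: sets_restrict_space_iff)
    show "AE t in ?M. (\<lambda>n. \<phi> n t *\<^sub>R v t) \<longlonglongrightarrow> ?f t"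
    proof (rule AE_I2)
      fix t
      have "(\<lambda>n. \<phi> n t *\<^sub>R v t) \<longlonglongrightarrow> ((if x < t then 1 else 0) - (if y < t then 1 else 0)) *\<^sub>R v t"
        unfolding \<phi>_def by (intro tendsto_intros LIMSEQ_scaled_smooth_step)
      then show "(\<lambda>n. \<phi> n t *\<^sub>R v t) \<longlonglongrightarrow> ?f t"
        using xy by (auto split: if_splits)
    qed
    show "AE t in ?M. norm (\<phi> n t *\<^sub>R v t) \<le> norm (v t)" for n
      using bd by (intro AE_I2) (simp add: mult_left_le_one_le)
  qed (use v in auto)
  \<comment> \<open>Only eventually, because the support [x, y + 2/n] has to end before b.\<close>
  moreover have "\<forall>\<^sub>F n in sequentially. (LINT t|?M. \<phi>' n t *\<^sub>R u t) = - (LINT t|?M. \<phi> n t *\<^sub>R v t)"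
  proof -
    obtain n0 :: nat where n0: "real n0 > 4 / (b - y)" using reals_Archimedean2 by blast
    show ?thesis
    proof (rule eventually_sequentiallyI)
      fix n assume "n0 \<le> n"
      then have n: "real n > 4 / (b - y)" using n0 by (meson less_le_trans of_nat_le_iff)
      moreover have "0 < 4 / (b - y)" using xy by simp
      ultimately have npos: "real n > 0" by linarith
      have e: "y + 2 / real n < b" using n npos xy by (simp add: field_simps)
      \<comment> \<open>Left of x both steps are 0; right of y + 2/n both are 1 and cancel.\<close>
      have "\<phi> n t = 0" if "t \<notin> {x..y + 2 / real n}" for t
      proof (cases "t < x")
        case True
        then have "real n * (t - x) \<le> 0" "real n * (t - y) \<le> 0"
          using xy by (auto simp: mult_nonneg_nonpos)
        then show ?thesis by (simp add: \<phi>_def smooth_step_eq_0)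
      next
        case False
        then have "2 / real n \<le> t - y" "2 / real n \<le> t - x" using that xy by auto
        then have "2 \<le> real n * (t - x)" "2 \<le> real n * (t - y)"
          using npos by (auto simp: field_simps)
        then show ?thesis by (simp add: \<phi>_def smooth_step_eq_1)
      qed
      then show "(LINT t|?M. \<phi>' n t *\<^sub>R u t) = - (LINT t|?M. \<phi> n t *\<^sub>R v t)"
        using w der cont' xy e unfolding weak_deriv_L2_def by blast
    qed
  qed
  ultimately have "(\<lambda>n. LINT t|?M. \<phi>' n t *\<^sub>R u t) \<longlonglongrightarrow> - (LINT t|?M. ?f t)"
    by (simp add: tendsto_cong tendsto_minus)
  then have "u x - u y = - (LINT t|?M. ?f t)" using lim1 LIMSEQ_unique by blast
  moreover have "(LINT t|?M. ?f t) = integral {x..y} v"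
  proof -
    have "integrable ?M ?f"
      using v by (intro Bochner_Integration.integrable_bound[OF v] measurable_If_set)
        (auto simp: sets_restrict_space_iff)
    then have "(LINT t|?M. ?f t) = integral {a..b} ?f" by (simp add: lebesgue_integral_eq_integral)
    also have "\<dots> = integral ({x<..y} \<inter> {a..b}) v" by (simp only: integral_restrict_Int Int_commute)
    also have "{x<..y} \<inter> {a..b} = {x<..y}" using xy by auto
    also have "integral {x<..y} v = integral {x..y} v"
      by (rule integral_spike_set; rule negligible_subset[OF negligible_sing[of x]]) auto
    finally show ?thesis .
  qed
  ultimately show ?thesis by (metis minus_diff_eq minus_minus)
qed

text \<open>Inside (a,b), u minus the indefinite integral of v is constant by the interior version;
  being continuous, it keeps that constant on the closed interval. This reaches the endpoint a,
  where the initial condition is posed.\<close>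

lemma weak_deriv_L2_integral:
  fixes u :: "real \<Rightarrow> 'v::euclidean_space"
  assumes w: "weak_deriv_L2 a b u v" and u: "continuous_on {a..b} u" and x: "x \<in> {a..b}"
  shows "u x - u a = integral {a..x} v"
proof (cases "a < b")
  case True
  have "integrable (lebesgue_on {a..b}) v" using w L2_on_integrable by (auto simp: weak_deriv_L2_def)
  then have v: "v integrable_on {a..b}" by (simp add: integrable_on_lebesgue_on)
  define g where "g x = u x - integral {a..x} v" for x
  have g: "continuous_on {a..b} g"
    unfolding g_def by (intro continuous_intros u indefinite_integral_continuous_1 v)
  define c where "c = (a + b) / 2"
  have less: "g y = g x" if "a < x" "x \<le> y" "y < b" for x y
  proof -
    have "integral {a..x} v + integral {x..y} v = integral {a..y} v"
      using that v by (intro Henstock_Kurzweil_Integration.integral_combine)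
        (auto intro: integrable_on_subinterval)
    then show ?thesis
      using weak_deriv_L2_integral_interior[OF w u that] by (simp add: g_def algebra_simps)
  qed
  have "g y = g c" if "y \<in> {a<..<b}" for y
    using less[of y c] less[of c y] that True by (cases "y \<le> c") (auto simp: c_def)
  then have "g y = g c" if "y \<in> {a..b}" for y
    using continuous_constant_on_closure[of "{a<..<b}" g "g c" y] g that True by simp
  then have "g x = g a" using x True by (metis atLeastAtMost_iff less_eq_real_def)
  then show ?thesis by (simp add: g_def algebra_simps)
next
  case False
  then have "x = a" using x by auto
  then show ?thesis by simp
qed

text \<open>Lebesgue differentiation: off a negligible set, w x is the limit of its averages over
  [x, x + h], and these are differences of vanishing integrals.\<close>

lemma AE_zero_of_integral_zero:
  fixes w :: "real \<Rightarrow> 'v::euclidean_space"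
  assumes w: "w integrable_on {a..b}" and z: "\<And>x. x \<in> {a..b} \<Longrightarrow> integral {a..x} w = 0"
  shows "AE x in lebesgue_on {a..b}. w x = 0"
proof -
  \<comment> \<open>Extended by zero because the differentiation theorem asks for integrability over
    every interval.\<close>
  define f where "f t = (if t \<in> {a..b} then w t else 0)" for t
  have "f integrable_on UNIV" unfolding f_def using w by (simp only: integrable_restrict_UNIV)
  then have "f integrable_on cbox c d" for c d
    by (rule integrable_on_subcbox) auto
  then obtain N where N: "negligible N" and
    lim: "\<And>x e. \<lbrakk>x \<notin> N; 0 < e\<rbrakk> \<Longrightarrow> \<exists>d>0. \<forall>h. 0 < h \<and> h < d \<longrightarrow>
        norm (integral (cbox x (x + h *\<^sub>R One)) f /\<^sub>R h ^ DIM(real) - f x) < e"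
    using integrable_ccontinuous_explicit by metis
  have zero: "w x = 0" if x: "x \<in> {a<..<b} - N" for x
  proof (rule ccontr)
    assume nz: "w x \<noteq> 0"
    have fx: "f x = w x" using x by (simp add: f_def)
    then obtain d where d: "d > 0" "\<And>h. 0 < h \<Longrightarrow> h < d \<Longrightarrow>
        norm (integral (cbox x (x + h *\<^sub>R One)) f /\<^sub>R h ^ DIM(real) - f x) < norm (w x)"
      using lim[of x "norm (w x)"] nz x by auto
    define h where "h = min d (b - x) / 2"
    have h: "0 < h" "h < d" "x + h \<le> b" using d x by (auto simp: h_def min_def field_simps)
    have "integral {x..x + h} f = integral {x..x + h} w"
      using x h by (intro Henstock_Kurzweil_Integration.integral_cong) (auto simp: f_def)
    moreover have "integral {a..x} w + integral {x..x+h} w = integral {a..x+h} w"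
      using x h w by (intro Henstock_Kurzweil_Integration.integral_combine)
        (auto intro: integrable_on_subinterval)
    ultimately have "integral {x..x + h} f = 0" using z x h by auto
    then show False using d(2)[OF h(1,2)] fx by simp
  qed
  have "negligible (N \<union> {a, b})" using N by (simp add: negligible_Un)
  then have "N \<union> {a, b} \<in> null_sets lebesgue" by (simp add: negligible_iff_null_sets)
  then have "AE x in lebesgue. x \<in> {a..b} \<longrightarrow> w x = 0"
    by (rule AE_I') (use zero in force)
  then show ?thesis by (simp add: AE_restrict_space_iff)
qed

text \<open>Both candidates have the indefinite integral u x - u a, so their difference integrates
  to 0 over every [a,x].\<close>

lemma weak_deriv_L2_unique:
  fixes u :: "real \<Rightarrow> 'v::euclidean_space"
  assumes w: "weak_deriv_L2 a b u v" "weak_deriv_L2 a b u v'" and u: "continuous_on {a..b} u"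
  shows "AE x in lebesgue_on {a..b}. v x = v' x"
proof -
  have v: "v integrable_on {a..b}" "v' integrable_on {a..b}"
    using w by (auto simp: weak_deriv_L2_def intro!: integrable_on_lebesgue_on L2_on_integrable)
  have "AE x in lebesgue_on {a..b}. v x - v' x = 0"
  proof (rule AE_zero_of_integral_zero)
    show "(\<lambda>x. v x - v' x) integrable_on {a..b}"
      using v by (rule integrable_diff)
    show "integral {a..x} (\<lambda>x. v x - v' x) = 0" if "x \<in> {a..b}" for x
    proof -
      have "v integrable_on {a..x}" "v' integrable_on {a..x}"
        using v that by (auto intro: integrable_on_subinterval)
      then show ?thesis
        using weak_deriv_L2_integral[OF w(1) u that] weak_deriv_L2_integral[OF w(2) u that]
        by (simp add: Henstock_Kurzweil_Integration.integral_diff)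
    qed
  qed
  then show ?thesis by simp
qed

section \<open>Square-integrable functions\<close>

definition L2_sq :: "real \<Rightarrow> real \<Rightarrow> (real \<Rightarrow> 'v::euclidean_space) \<Rightarrow> real" where
  "L2_sq a b u = (LINT y|lebesgue_on {a..b}. (norm (u y))\<^sup>2)"

lemma L2_sq_nonneg: "0 \<le> L2_sq a b u"
  unfolding L2_sq_def by (rule Bochner_Integration.integral_nonneg) simp

lemma L2_on_dominated:
  assumes u: "u \<in> borel_measurable (lebesgue_on {a..b})"
    and f: "integrable (lebesgue_on {a..b}) f"
    and le: "\<And>y. y \<in> {a..b} \<Longrightarrow> (norm (u y))\<^sup>2 \<le> f y"
  shows "L2_on a b u" "L2_sq a b u \<le> (LINT y|lebesgue_on {a..b}. f y)"
proof -
  show i: "L2_on a b u"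
    unfolding L2_on_def
  proof (intro conjI u Bochner_Integration.integrable_bound[OF f])
    show "AE y in lebesgue_on {a..b}. norm ((norm (u y))\<^sup>2) \<le> norm (f y)"
      using order.trans[OF le abs_ge_self] by (intro AE_I2) simp
  qed (use u in auto)
  then show "L2_sq a b u \<le> (LINT y|lebesgue_on {a..b}. f y)"
    unfolding L2_sq_def L2_on_def using f le by (intro integral_mono) auto
qed

text \<open>The squared substitute for the triangle inequality; c = 1 and c = -1 handle sums and
  differences in all later norm estimates.\<close>

lemma norm_add_scaleR_sq_le:
  fixes x y :: "'v::real_normed_vector"
  shows "(norm (x + c *\<^sub>R y))\<^sup>2 \<le> 2 * (norm x)\<^sup>2 + 2 * c\<^sup>2 * (norm y)\<^sup>2"
proof -
  have "(norm (x + c *\<^sub>R y))\<^sup>2 \<le> (norm x + \<bar>c\<bar> * norm y)\<^sup>2"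
    using norm_triangle_ineq[of x "c *\<^sub>R y"] by (intro power_mono) auto
  also have "\<dots> \<le> 2 * (norm x)\<^sup>2 + 2 * (\<bar>c\<bar> * norm y)\<^sup>2"
    using zero_le_power2[of "norm x - \<bar>c\<bar> * norm y"] by (simp add: power2_sum power2_diff)
  finally show ?thesis by (simp add: power_mult_distrib)
qed

lemma L2_on_add_scaleR:
  assumes "L2_on a b u" "L2_on a b v"
  shows "L2_on a b (\<lambda>y. u y + c *\<^sub>R v y)"
    and "L2_sq a b (\<lambda>y. u y + c *\<^sub>R v y) \<le> 2 * L2_sq a b u + 2 * c\<^sup>2 * L2_sq a b v"
proof -
  let ?f = "\<lambda>y. 2 * (norm (u y))\<^sup>2 + 2 * c\<^sup>2 * (norm (v y))\<^sup>2"
  have m: "(\<lambda>y. u y + c *\<^sub>R v y) \<in> borel_measurable (lebesgue_on {a..b})"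
    using assms by (auto simp: L2_on_def)
  have i: "integrable (lebesgue_on {a..b}) ?f"
    using assms by (auto simp: L2_on_def)
  show "L2_on a b (\<lambda>y. u y + c *\<^sub>R v y)"
    by (rule L2_on_dominated[OF m i]) (rule norm_add_scaleR_sq_le)
  have "L2_sq a b (\<lambda>y. u y + c *\<^sub>R v y) \<le> (LINT y|lebesgue_on {a..b}. ?f y)"
    by (rule L2_on_dominated[OF m i]) (rule norm_add_scaleR_sq_le)
  also have "\<dots> = 2 * L2_sq a b u + 2 * c\<^sup>2 * L2_sq a b v"
    using assms by (simp add: L2_on_def L2_sq_def)
  finally show "L2_sq a b (\<lambda>y. u y + c *\<^sub>R v y) \<le> 2 * L2_sq a b u + 2 * c\<^sup>2 * L2_sq a b v" .
qed

lemma L2_on_le_const: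
  assumes "u \<in> borel_measurable (lebesgue_on {a..b})" "a \<le> b"
    and "\<And>y. y \<in> {a..b} \<Longrightarrow> norm (u y) \<le> c"
  shows "L2_on a b u" "L2_sq a b u \<le> (b - a) * c\<^sup>2"
proof -
  have *: "(norm (u y))\<^sup>2 \<le> c\<^sup>2" if "y \<in> {a..b}" for y
    using assms(3)[OF that] by (simp add: power_mono)
  have i: "integrable (lebesgue_on {a..b}) (\<lambda>y. c\<^sup>2)"
    by (intro continuous_imp_integrable_real continuous_intros)
  show "L2_on a b u" "L2_sq a b u \<le> (b - a) * c\<^sup>2"
    using L2_on_dominated[OF assms(1) i *] \<open>a \<le> b\<close>
    by (auto simp: measure_restrict_space)
qed

lemma L2_on_scaled:
  assumes "u \<in> borel_measurable (lebesgue_on {a..b})" "L2_on a b v"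
    and "\<And>y. y \<in> {a..b} \<Longrightarrow> norm (u y) \<le> c * norm (v y)"
  shows "L2_on a b u" "L2_sq a b u \<le> c\<^sup>2 * L2_sq a b v"
proof -
  have *: "(norm (u y))\<^sup>2 \<le> c\<^sup>2 * (norm (v y))\<^sup>2" if "y \<in> {a..b}" for y
    using power_mono[OF assms(3)[OF that], of 2] by (simp add: power_mult_distrib)
  have i: "integrable (lebesgue_on {a..b}) (\<lambda>y. c\<^sup>2 * (norm (v y))\<^sup>2)"
    using assms(2) by (auto simp: L2_on_def)
  show "L2_on a b u" "L2_sq a b u \<le> c\<^sup>2 * L2_sq a b v"
    using L2_on_dominated[OF assms(1) i *] by (auto simp: L2_sq_def)
qed

lemma L2_sq_cong_AE:
  assumes "AE y in lebesgue_on {a..b}. u y = v y"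
    and "u \<in> borel_measurable (lebesgue_on {a..b})" "v \<in> borel_measurable (lebesgue_on {a..b})"
  shows "L2_sq a b u = L2_sq a b v"
  unfolding L2_sq_def using assms by (intro integral_cong_AE) auto

text \<open>Cauchy-Schwarz in variance form: with m the mean of |u|, the integral of (|u| - m)^2 is
  nonnegative.\<close>

lemma integral_norm_le_L2:
  assumes "L2_on a b u" "a < b"
  shows "(integral {a..b} (\<lambda>y. norm (u y)))\<^sup>2 \<le> (b - a) * L2_sq a b u"
proof -
  let ?M = "lebesgue_on {a..b}"
  define m where "m = integral {a..b} (\<lambda>y. norm (u y)) / (b - a)"
  have int: "integrable ?M (\<lambda>y. norm (u y))" "integrable ?M (\<lambda>y. (norm (u y))\<^sup>2)"
    using assms L2_on_integrable by (auto simp: L2_on_def)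
  have M: "(LINT y|?M. norm (u y)) = m * (b - a)"
    using int assms by (simp add: lebesgue_integral_eq_integral m_def)
  have c: "integrable ?M (\<lambda>y. m\<^sup>2)"
    by (intro continuous_imp_integrable_real continuous_intros)
  have "0 \<le> (LINT y|?M. (norm (u y) - m)\<^sup>2)"
    by (rule Bochner_Integration.integral_nonneg) simp
  also have "\<dots> = (LINT y|?M. (norm (u y))\<^sup>2 - 2 * m * norm (u y) + m\<^sup>2)"
    by (simp add: power2_diff algebra_simps)
  also have "\<dots> = L2_sq a b u - 2 * m * (m * (b - a)) + (b - a) * m\<^sup>2"
    using int c assms by (simp add: M L2_sq_def measure_restrict_space)
  also have "\<dots> = L2_sq a b u - (b - a) * m\<^sup>2"
    by (simp add: power2_eq_square algebra_simps)
  finally have "(b - a) * ((b - a) * m\<^sup>2) \<le> (b - a) * L2_sq a b u"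
    using assms by (intro mult_left_mono) auto
  then show ?thesis
    using assms by (simp add: m_def power2_eq_square)
qed

lemma weak_deriv_L2_add_scaleR:
  fixes u1 u2 :: "real \<Rightarrow> 'v::euclidean_space"
  assumes w: "weak_deriv_L2 a b u1 v1" "weak_deriv_L2 a b u2 v2"
    and u: "continuous_on {a..b} u1" "continuous_on {a..b} u2"
  shows "weak_deriv_L2 a b (\<lambda>y. u1 y + c *\<^sub>R u2 y) (\<lambda>y. v1 y + c *\<^sub>R v2 y)"
  unfolding weak_deriv_L2_def
proof (intro conjI allI impI)
  show "L2_on a b (\<lambda>y. v1 y + c *\<^sub>R v2 y)"
    using w L2_on_add_scaleR(1) by (auto simp: weak_deriv_L2_def)
  fix \<phi> \<phi>' :: "real \<Rightarrow> real"
  assume \<phi>: "(\<forall>y. (\<phi> has_real_derivative \<phi>' y) (at y)) \<and> continuous_on UNIV \<phi>' \<and>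
        (\<exists>c e. a < c \<and> e < b \<and> (\<forall>y. y \<notin> {c..e} \<longrightarrow> \<phi> y = 0))"
  let ?M = "lebesgue_on {a..b}"
  have c\<phi>: "continuous_on {a..b} \<phi>"
    using \<phi> by (meson DERIV_isCont continuous_at_imp_continuous_on)
  have c\<phi>': "continuous_on {a..b} \<phi>'"
    using \<phi> continuous_on_subset by blast
  \<comment> \<open>The bound makes the products of the test function with v1 and v2 integrable,
    without which the integral of the sum could not be split.\<close>
  obtain B where B: "\<And>y. y \<in> {a..b} \<Longrightarrow> norm (\<phi> y) \<le> B"
    using compact_imp_bounded[OF compact_continuous_image[OF c\<phi> compact_Icc]]
    unfolding bounded_iff by (metis imageI)
  have iu: "integrable ?M (\<lambda>y. \<phi>' y *\<^sub>R u1 y)" "integrable ?M (\<lambda>y. \<phi>' y *\<^sub>R u2 y)"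
    by (intro continuous_imp_integrable_real continuous_on_scaleR c\<phi>' u)+
  have iv: "integrable ?M (\<lambda>y. \<phi> y *\<^sub>R v y)" if v: "L2_on a b v" for v :: "real \<Rightarrow> 'v"
  proof (rule Bochner_Integration.integrable_bound)
    show "integrable ?M (\<lambda>y. B *\<^sub>R v y)" using L2_on_integrable[OF v] by auto
    show "(\<lambda>y. \<phi> y *\<^sub>R v y) \<in> borel_measurable ?M"
      using v continuous_imp_measurable_on_sets_lebesgue[OF c\<phi>] by (auto simp: L2_on_def)
    have "norm (\<phi> y *\<^sub>R v y) \<le> norm (B *\<^sub>R v y)" if "y \<in> {a..b}" for y
      using B[OF that] by (auto intro!: mult_right_mono)
    then show "AE y in ?M. norm (\<phi> y *\<^sub>R v y) \<le> norm (B *\<^sub>R v y)" by (intro AE_I2) simp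
  qed
  have v: "integrable ?M (\<lambda>y. \<phi> y *\<^sub>R v1 y)" "integrable ?M (\<lambda>y. \<phi> y *\<^sub>R v2 y)"
    using w iv by (auto simp: weak_deriv_L2_def)
  have e: "(LINT y|?M. \<phi>' y *\<^sub>R u1 y) = - (LINT y|?M. \<phi> y *\<^sub>R v1 y)"
    "(LINT y|?M. \<phi>' y *\<^sub>R u2 y) = - (LINT y|?M. \<phi> y *\<^sub>R v2 y)"
    using w \<phi> unfolding weak_deriv_L2_def by blast+
  have "(LINT y|?M. \<phi>' y *\<^sub>R (u1 y + c *\<^sub>R u2 y))
    = (LINT y|?M. \<phi>' y *\<^sub>R u1 y + c *\<^sub>R (\<phi>' y *\<^sub>R u2 y))"
    by (simp add: scaleR_right_distrib mult.commute)
  also have "\<dots> = (LINT y|?M. \<phi>' y *\<^sub>R u1 y) + c *\<^sub>R (LINT y|?M. \<phi>' y *\<^sub>R u2 y)"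
    using iu by (simp del: scaleR_scaleR)
  also have "\<dots> = - ((LINT y|?M. \<phi> y *\<^sub>R v1 y) + c *\<^sub>R (LINT y|?M. \<phi> y *\<^sub>R v2 y))"
    by (simp add: e)
  also have "\<dots> = - (LINT y|?M. \<phi> y *\<^sub>R v1 y + c *\<^sub>R (\<phi> y *\<^sub>R v2 y))"
    using v by (simp del: scaleR_scaleR)
  also have "\<dots> = - (LINT y|?M. \<phi> y *\<^sub>R (v1 y + c *\<^sub>R v2 y))"
    by (simp add: scaleR_right_distrib mult.commute)
  finally show "(LINT y|?M. \<phi>' y *\<^sub>R (u1 y + c *\<^sub>R u2 y)) = - (LINT y|?M. \<phi> y *\<^sub>R (v1 y + c *\<^sub>R v2 y))" .
qed

text \<open>Integrating factor: exp(-l(y - a)) times the right-hand side of \<open>le\<close> starts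
  at F and is nonincreasing, since its derivative is a nonnegative multiple of S minus that
  right-hand side.\<close>

lemma gronwall:
  fixes S :: "real \<Rightarrow> real"
  assumes S: "continuous_on {a..b} S" and l: "0 \<le> l"
    and le: "\<And>y. y \<in> {a..b} \<Longrightarrow> S y \<le> F + l * integral {a..y} S"
    and y: "y \<in> {a..b}"
  shows "S y \<le> F * exp (l * (y - a))"
proof -
  define g where "g y = exp (- l * (y - a)) * (F + l * integral {a..y} S)" for y
  have der: "(g has_real_derivative exp (- l * (x - a)) * l * (S x - (F + l * integral {a..x} S)))
      (at x within {a..b})" if "x \<in> {a..b}" for x
  proof -
    have "((\<lambda>y. integral {a..y} S) has_real_derivative S x) (at x within {a..b})"
      using integral_has_real_derivative[OF S that] .
    then show ?thesis
      unfolding g_def by (auto intro!: derivative_eq_intros simp: algebra_simps)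
  qed
  have "g y \<le> g a"
  proof (rule DERIV_nonpos_imp_decreasing_open[of a y g])
    show "a \<le> y" using y by simp
    show "continuous_on {a..y} g"
      by (rule continuous_on_subset[of "{a..b}"]) (use DERIV_continuous_on[OF der] y in auto)
    fix x assume x: "a < x" "x < y"
    have "(g has_real_derivative exp (- l * (x - a)) * l * (S x - (F + l * integral {a..x} S))) (at x)"
      using der[of x] x y by (simp add: at_within_Icc_at)
    moreover have "exp (- l * (x - a)) * l * (S x - (F + l * integral {a..x} S)) \<le> 0"
      using le[of x] x y l by (intro mult_nonneg_nonpos) auto
    ultimately show "\<exists>z. (g has_real_derivative z) (at x) \<and> z \<le> 0" by blast
  qed
  then have "exp (l * (y - a)) * g y \<le> exp (l * (y - a)) * g a"
    by (rule mult_left_mono) simp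
  moreover have "exp (l * (y - a)) * g y = F + l * integral {a..y} S"
    by (simp add: g_def exp_minus)
  moreover have "g a = F" by (simp add: g_def)
  ultimately have "F + l * integral {a..y} S \<le> F * exp (l * (y - a))"
    by (metis mult.commute)
  with le[OF y] show ?thesis by linarith
qed

section \<open>Stability of the semi-discrete system\<close>

lemma H1hD:
  assumes "U \<in> H1h a b K h" "j \<in> {1..<K}"
  shows "continuous_on {a..b} (U j)" "weak_deriv_L2 a b (U j) (grid_dy a b U j)"
    "L2_on a b (U j)" "L2_on a b (grid_dx h U j)" "L2_on a b (grid_dy a b U j)"
proof -
  show "continuous_on {a..b} (U j)" "L2_on a b (U j)" "L2_on a b (grid_dx h U j)"
    using assms by (auto simp: H1h_def)
  have "\<exists>v. weak_deriv_L2 a b (U j) v" using assms by (auto simp: H1h_def)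
  then show "weak_deriv_L2 a b (U j) (grid_dy a b U j)"
    unfolding grid_dy_def by (rule someI_ex)
  then show "L2_on a b (grid_dy a b U j)" by (simp add: weak_deriv_L2_def)
qed

lemma grid_dx_add_scaleR:
  "grid_dx h (\<lambda>j y. U j y + c *\<^sub>R V j y) = (\<lambda>j y. grid_dx h U j y + c *\<^sub>R grid_dx h V j y)"
  by (auto simp: fun_eq_iff grid_dx_def scaleR_add_right scaleR_diff_right mult.commute)

lemma H1h_add_scaleR:
  assumes "U \<in> H1h a b K h" "V \<in> H1h a b K h"
  shows "(\<lambda>j y. U j y + c *\<^sub>R V j y) \<in> H1h a b K h"
  unfolding H1h_def
proof (intro CollectI ballI conjI)
  fix j assume j: "j \<in> {1..<K}"
  note U = H1hD[OF assms(1) j] and V = H1hD[OF assms(2) j]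
  show "continuous_on {a..b} (\<lambda>y. U j y + c *\<^sub>R V j y)"
    by (intro continuous_intros U V)
  show "\<exists>v. weak_deriv_L2 a b (\<lambda>y. U j y + c *\<^sub>R V j y) v"
    using weak_deriv_L2_add_scaleR[OF U(2) V(2) U(1) V(1)] by blast
  show "L2_on a b (\<lambda>y. U j y + c *\<^sub>R V j y)"
    by (rule L2_on_add_scaleR(1)[OF U(3) V(3)])
  show "L2_on a b (grid_dx h (\<lambda>j y. U j y + c *\<^sub>R V j y) j)"
    unfolding grid_dx_add_scaleR by (rule L2_on_add_scaleR(1)[OF U(4) V(4)])
qed

text \<open>The choice in \<open>grid_dy\<close> is made separately for each function, so additivity
  is available only almost everywhere, through uniqueness of weak derivatives.\<close>

lemma grid_dy_add_scaleR:
  assumes "U \<in> H1h a b K h" "V \<in> H1h a b K h" and j: "j \<in> {1..<K}"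
  shows "AE y in lebesgue_on {a..b}.
    grid_dy a b (\<lambda>j y. U j y + c *\<^sub>R V j y) j y = grid_dy a b U j y + c *\<^sub>R grid_dy a b V j y"
proof (rule weak_deriv_L2_unique)
  note U = H1hD[OF assms(1) j] and V = H1hD[OF assms(2) j]
    and UV = H1hD[OF H1h_add_scaleR[OF assms(1,2), of c] j]
  show "weak_deriv_L2 a b (\<lambda>y. U j y + c *\<^sub>R V j y) (grid_dy a b (\<lambda>j y. U j y + c *\<^sub>R V j y) j)"
    by (rule UV(2))
  show "weak_deriv_L2 a b (\<lambda>y. U j y + c *\<^sub>R V j y) (\<lambda>y. grid_dy a b U j y + c *\<^sub>R grid_dy a b V j y)"
    by (rule weak_deriv_L2_add_scaleR[OF U(2) V(2) U(1) V(1)])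
  show "continuous_on {a..b} (\<lambda>y. U j y + c *\<^sub>R V j y)" by (rule UV(1))
qed

lemma H1h_norm_square:
  assumes "U \<in> H1h a b K h" "0 < h"
  shows "(H1h_norm a b K h U)\<^sup>2 = (\<Sum>j\<in>{1..<K}. h *
    (L2_sq a b (grid_dx h U j) + L2_sq a b (grid_dy a b U j) + L2_sq a b (U j)))"
proof -
  have "(LINT y|lebesgue_on {a..b}. (norm (grid_dx h U j y))\<^sup>2 + (norm (grid_dy a b U j y))\<^sup>2 + (norm (U j y))\<^sup>2)
    = L2_sq a b (grid_dx h U j) + L2_sq a b (grid_dy a b U j) + L2_sq a b (U j)"
    if "j \<in> {1..<K}" for j
    using H1hD[OF assms(1) that] by (simp add: L2_on_def L2_sq_def)
  then have "H1h_norm a b K h U = sqrt (\<Sum>j\<in>{1..<K}. h *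
    (L2_sq a b (grid_dx h U j) + L2_sq a b (grid_dy a b U j) + L2_sq a b (U j)))"
    by (simp add: H1h_norm_def)
  then show ?thesis
    using assms(2) by (simp add: sum_nonneg L2_sq_nonneg)
qed

lemma H1h_norm_add_scaleR:
  assumes U: "U \<in> H1h a b K h" and V: "V \<in> H1h a b K h" and h: "0 < h"
  shows "(H1h_norm a b K h (\<lambda>j y. U j y + c *\<^sub>R V j y))\<^sup>2
    \<le> 2 * (H1h_norm a b K h U)\<^sup>2 + 2 * c\<^sup>2 * (H1h_norm a b K h V)\<^sup>2"
proof -
  let ?UV = "\<lambda>j y. U j y + c *\<^sub>R V j y"
  have UV: "?UV \<in> H1h a b K h" by (rule H1h_add_scaleR[OF U V])
  let ?q = "\<lambda>U j. L2_sq a b (grid_dx h U j) + L2_sq a b (grid_dy a b U j) + L2_sq a b (U j)"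
  have "h * ?q ?UV j \<le> 2 * (h * ?q U j) + 2 * c\<^sup>2 * (h * ?q V j)" if j: "j \<in> {1..<K}" for j
  proof -
    note u = H1hD[OF U j] and v = H1hD[OF V j] and uv = H1hD[OF UV j]
    have "L2_sq a b (grid_dy a b ?UV j) = L2_sq a b (\<lambda>y. grid_dy a b U j y + c *\<^sub>R grid_dy a b V j y)"
      using grid_dy_add_scaleR[OF U V j] uv(5) L2_on_add_scaleR(1)[OF u(5) v(5)]
      by (intro L2_sq_cong_AE) (auto simp: L2_on_def)
    then have "?q ?UV j \<le> 2 * ?q U j + 2 * c\<^sup>2 * ?q V j"
      using L2_on_add_scaleR(2)[OF u(3) v(3), of c] L2_on_add_scaleR(2)[OF u(4) v(4), of c]
        L2_on_add_scaleR(2)[OF u(5) v(5), of c]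
      by (simp add: grid_dx_add_scaleR distrib_left)
    then have "h * ?q ?UV j \<le> h * (2 * ?q U j + 2 * c\<^sup>2 * ?q V j)"
      using h by (intro mult_left_mono) auto
    then show ?thesis by (simp add: algebra_simps)
  qed
  then have "(\<Sum>j\<in>{1..<K}. h * ?q ?UV j) \<le> (\<Sum>j\<in>{1..<K}. 2 * (h * ?q U j) + 2 * c\<^sup>2 * (h * ?q V j))"
    by (rule sum_mono)
  then show ?thesis
    by (simp only: H1h_norm_square[OF U h] H1h_norm_square[OF V h] H1h_norm_square[OF UV h]
      sum.distrib sum_distrib_left)
qed

text \<open>The stability argument sees D only through its continuity in y and the bound
  \<open>C\<close>. \<open>h0\<close> bounds the mesh size from below and \<open>\<kappa>\<close>
  the number of grid lines from above; the constants are written in these instead of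
  \<open>h\<close> and \<open>K\<close>, so that one value serves every admissible mesh.\<close>

locale grid_system =
  fixes a b h h0 \<kappa> C :: real and K :: nat and D :: "nat \<Rightarrow> real \<Rightarrow> ('n::finite) rmat"
  assumes ab: "a < b" and h0: "0 < h0" "h0 \<le> h" and K: "real K \<le> \<kappa>" and C: "0 \<le> C"
    and D_cont: "\<And>j. j \<in> {1..<K} \<Longrightarrow> continuous_on {a..b} (D j)"
    and D_bound: "\<And>j y. j \<in> {1..<K} \<Longrightarrow> y \<in> {a..b} \<Longrightarrow> norm (D j y) \<le> C"
begin

definition L :: "(nat \<Rightarrow> real \<Rightarrow> 'n rvec) \<Rightarrow> nat \<Rightarrow> real \<Rightarrow> 'n rvec" where
  "L U j y = grid_dy a b U j y + D j y *v grid_dx h U j y"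

definition L_sq :: "(nat \<Rightarrow> real \<Rightarrow> 'n rvec) \<Rightarrow> real" where
  "L_sq U = (\<Sum>j\<in>{1..<K}. h * L2_sq a b (L U j))"

lemma h_pos: "0 < h" using h0 by linarith

lemma L_sq_nonneg: "0 \<le> L_sq U"
  using h_pos by (auto simp: L_sq_def intro!: sum_nonneg mult_nonneg_nonneg L2_sq_nonneg)

text \<open>Entries of D are continuous, hence measurable, and each component is a finite sum of
  products.\<close>

lemma D_mult_measurable:
  assumes j: "j \<in> {1..<K}" and u: "u \<in> borel_measurable (lebesgue_on {a..b})"
  shows "(\<lambda>y. D j y *v u y) \<in> borel_measurable (lebesgue_on {a..b})"
proof -
  have nth: "(\<lambda>x :: 'n rvec. x $ k) \<in> borel_measurable borel" for k
    by (intro borel_measurable_continuous_onI continuous_intros)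
  have uk: "(\<lambda>y. u y $ k) \<in> borel_measurable (lebesgue_on {a..b})" for k
    using measurable_compose[OF u nth] .
  have "continuous_on {a..b} (\<lambda>y. D j y $ i $ k)" for i k
    by (intro continuous_intros D_cont j)
  then have Dik: "(\<lambda>y. D j y $ i $ k) \<in> borel_measurable (lebesgue_on {a..b})" for i k
    by (rule continuous_imp_measurable_on_sets_lebesgue) auto
  have "(\<lambda>y. (D j y *v u y) $ i) \<in> borel_measurable (lebesgue_on {a..b})" for i
    unfolding matrix_vector_mult_def vec_lambda_beta
    by (intro borel_measurable_sum borel_measurable_times Dik uk)
  then show ?thesis
    by (subst borel_measurable_euclidean_space) (auto simp: Basis_vec_def inner_axis)
qed

lemma D_mult_norm:
  assumes "j \<in> {1..<K}" "y \<in> {a..b}"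
  shows "norm (D j y *v x) \<le> C * norm x"
  using norm_matrix_vector_mult_le[of "D j y" x] D_bound[OF assms]
  by (meson mult_right_mono norm_ge_zero order.trans)

lemma D_grid_dx_L2:
  assumes "U \<in> H1h a b K h" "j \<in> {1..<K}"
  shows "L2_on a b (\<lambda>y. D j y *v grid_dx h U j y)"
    "L2_sq a b (\<lambda>y. D j y *v grid_dx h U j y) \<le> C\<^sup>2 * L2_sq a b (grid_dx h U j)"
  using L2_on_scaled[OF D_mult_measurable[OF assms(2)] H1hD(4)[OF assms] D_mult_norm[OF assms(2)]]
    H1hD(4)[OF assms] by (auto simp: L2_on_def)

lemma L_L2:
  assumes "U \<in> H1h a b K h" "j \<in> {1..<K}"
  shows "L2_on a b (L U j)"
    "L2_sq a b (L U j) \<le> 2 * L2_sq a b (grid_dy a b U j) + 2 * C\<^sup>2 * L2_sq a b (grid_dx h U j)"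
  using L2_on_add_scaleR[OF H1hD(5)[OF assms] D_grid_dx_L2(1)[OF assms], of 1]
    D_grid_dx_L2(2)[OF assms] by (auto simp: L_def[abs_def])

lemma L_sq_le_H1h_norm:
  assumes U: "U \<in> H1h a b K h"
  shows "L_sq U \<le> 2 * (1 + C\<^sup>2) * (H1h_norm a b K h U)\<^sup>2"
proof -
  have "h * L2_sq a b (L U j) \<le> 2 * (1 + C\<^sup>2) * (h *
      (L2_sq a b (grid_dx h U j) + L2_sq a b (grid_dy a b U j) + L2_sq a b (U j)))"
    if j: "j \<in> {1..<K}" for j
  proof -
    \<comment> \<open>Up to a factor 2, these are the terms by which 2(1 + C^2) times the full sum
      exceeds the bound on \<open>L U j\<close>.\<close>
    have "0 \<le> L2_sq a b (grid_dx h U j)" "0 \<le> C\<^sup>2 * L2_sq a b (grid_dy a b U j)"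
      "0 \<le> (1 + C\<^sup>2) * L2_sq a b (U j)"
      by (auto intro!: mult_nonneg_nonneg L2_sq_nonneg)
    then have "L2_sq a b (L U j) \<le> 2 * (1 + C\<^sup>2) *
      (L2_sq a b (grid_dx h U j) + L2_sq a b (grid_dy a b U j) + L2_sq a b (U j))"
      using L_L2(2)[OF U j] by (simp add: algebra_simps)
    then have "h * L2_sq a b (L U j) \<le> h * (2 * (1 + C\<^sup>2) *
      (L2_sq a b (grid_dx h U j) + L2_sq a b (grid_dy a b U j) + L2_sq a b (U j)))"
      using h_pos by (intro mult_left_mono) auto
    then show ?thesis by (simp only: mult_ac)
  qed
  then show ?thesis
    unfolding L_sq_def H1h_norm_square[OF U h_pos] sum_distrib_left by (rule sum_mono)
qed

lemma L_sq_add_scaleR: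
  assumes U: "U \<in> H1h a b K h" and V: "V \<in> H1h a b K h"
  shows "L_sq (\<lambda>j y. U j y + c *\<^sub>R V j y) \<le> 2 * L_sq U + 2 * c\<^sup>2 * L_sq V"
proof -
  let ?UV = "\<lambda>j y. U j y + c *\<^sub>R V j y"
  have UV: "?UV \<in> H1h a b K h" by (rule H1h_add_scaleR[OF U V])
  have "h * L2_sq a b (L ?UV j) \<le> 2 * (h * L2_sq a b (L U j)) + 2 * c\<^sup>2 * (h * L2_sq a b (L V j))"
    if j: "j \<in> {1..<K}" for j
  proof -
    note l = L2_on_add_scaleR[OF L_L2(1)[OF U j] L_L2(1)[OF V j], of c]
    have mv: "A *v (p + c *\<^sub>R q) = A *v p + c *\<^sub>R (A *v q)" for A :: "'n rmat" and p q
      by (metis matrix_vector_right_distrib matrix_vector_mult_scaleR)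
    have "AE y in lebesgue_on {a..b}. L ?UV j y = L U j y + c *\<^sub>R L V j y"
      using grid_dy_add_scaleR[OF U V j, of c]
      by eventually_elim (simp add: L_def grid_dx_add_scaleR mv scaleR_add_right)
    then have "L2_sq a b (L ?UV j) = L2_sq a b (\<lambda>y. L U j y + c *\<^sub>R L V j y)"
      using l(1) L_L2(1)[OF UV j] by (intro L2_sq_cong_AE) (auto simp: L2_on_def)
    then have "h * L2_sq a b (L ?UV j) \<le> h * (2 * L2_sq a b (L U j) + 2 * c\<^sup>2 * L2_sq a b (L V j))"
      using l(2) h_pos by (intro mult_left_mono) auto
    then show ?thesis by (simp add: algebra_simps)
  qed
  then have "L_sq ?UV \<le> (\<Sum>j\<in>{1..<K}. 2 * (h * L2_sq a b (L U j)) + 2 * c\<^sup>2 * (h * L2_sq a b (L V j)))"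
    unfolding L_sq_def by (rule sum_mono)
  then show ?thesis by (simp add: L_sq_def sum.distrib sum_distrib_left)
qed

lemma L_sq_eq_0:
  assumes U: "U \<in> H1h a b K h"
    and 0: "\<And>j. j \<in> {1..<K} \<Longrightarrow> AE y in lebesgue_on {a..b}. L U j y = 0"
  shows "L_sq U = 0"
proof -
  have "L2_sq a b (L U j) = 0" if j: "j \<in> {1..<K}" for j
  proof -
    have "L2_sq a b (L U j) = L2_sq a b (\<lambda>_. 0 :: 'n rvec)"
      using 0[OF j] L_L2(1)[OF U j] by (intro L2_sq_cong_AE) (auto simp: L2_on_def)
    then show ?thesis by (simp add: L2_sq_def)
  qed
  then show ?thesis by (simp add: L_sq_def)
qed

section \<open>Gronwall estimate with explicit constants\<close>

definition growth :: real where
  "growth = exp (\<kappa> * C / h0 * (b - a))"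

text \<open>The 2 comes from LW in the bound for W_y. In the second term one \<open>\<kappa>\<close>
  sums over the grid lines and \<open>\<kappa>\<close>^2 comes from F^2; one factor b - a is the
  length of the interval, the other Cauchy-Schwarz. The bracket collects W, then W_x with 1/h0^2,
  then D W_x with 2C^2/h0^2.\<close>

definition stability :: real where
  "stability = 2 + \<kappa> ^ 3 * (b - a)\<^sup>2 * growth\<^sup>2 * (1 + (1 + 2 * C\<^sup>2) / h0\<^sup>2)"

text \<open>Line j is coupled to its two neighbours, so no single |W_j| satisfies a closed
  inequality, but the sum S over all lines does. The resulting uniform bound on S controls W and
  W_x, and the equation then controls W_y.\<close>

lemma stability_estimate:
  assumes W: "W \<in> H1h a b K h"
    and Wa: "\<And>j. j \<in> {1..<K} \<Longrightarrow> W j a = 0"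
    and W0: "\<And>y. y \<in> {a..b} \<Longrightarrow> W 0 y = 0" and WK: "\<And>y. y \<in> {a..b} \<Longrightarrow> W K y = 0"
  shows "(H1h_norm a b K h W)\<^sup>2 \<le> stability * L_sq W"
proof -
  define S where "S y = (\<Sum>j\<in>{1..<K}. norm (W j y))" for y
  define \<Phi> where "\<Phi> = (\<Sum>j\<in>{1..<K}. L2_sq a b (L W j))"
  define F where "F = (\<Sum>j\<in>{1..<K}. sqrt ((b - a) * L2_sq a b (L W j)))"
  note w = H1hD[OF W]
  have \<kappa>: "0 \<le> \<kappa>" using K of_nat_0_le_iff[of K] by linarith
  have S_cont: "continuous_on {a..b} S"
    unfolding S_def by (intro continuous_intros w(1))
  have S_nonneg: "0 \<le> S y" for y by (simp add: S_def sum_nonneg)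
  \<comment> \<open>The indices 0 and K are included because the difference quotients at j = 1 and j
    = K - 1 reach them; here the zero lateral data enter.\<close>
  have W_le: "norm (W j y) \<le> S y" if j: "j \<le> K" and y: "y \<in> {a..b}" for j y
  proof -
    consider "j = 0" | "j = K" | "j \<in> {1..<K}" using j by fastforce
    then show ?thesis
    proof cases
      case 3
      then show ?thesis
        unfolding S_def using member_le_sum[of j "{1..<K}" "\<lambda>j. norm (W j y)"] by simp
    qed (use W0 WK S_nonneg y in auto)
  qed
  have dx_le: "norm (grid_dx h W j y) \<le> S y / h0" if j: "j \<in> {1..<K}" and y: "y \<in> {a..b}" for j y
  proof -
    have "norm (W (j + 1) y) \<le> S y" "norm (W (j - 1) y) \<le> S y"
      by (rule W_le; use j y in auto)+
    then have "norm (W (j + 1) y - W (j - 1) y) \<le> S y + S y"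
      using norm_triangle_ineq4[of "W (j + 1) y" "W (j - 1) y"] by linarith
    then have "norm (grid_dx h W j y) \<le> S y / h"
      using h_pos by (simp add: grid_dx_def pos_divide_le_eq pos_le_divide_eq mult.commute)
    also have "\<dots> \<le> S y / h0" using h0 S_nonneg by (intro divide_left_mono) auto
    finally show ?thesis .
  qed
  have dy: "grid_dy a b W j y = L W j y - D j y *v grid_dx h W j y" for j y by (simp add: L_def)
  have W_int: "norm (W j y) \<le> sqrt ((b - a) * L2_sq a b (L W j)) + C / h0 * integral {a..y} S"
    if j: "j \<in> {1..<K}" and y: "y \<in> {a..b}" for j y
  proof -
    have "grid_dy a b W j integrable_on {a..b}"
      by (intro integrable_on_lebesgue_on L2_on_integrable w(5) j) auto
    then have dy_int: "grid_dy a b W j integrable_on {a..y}"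
      by (rule integrable_on_subinterval) (use y in auto)
    have "integrable (lebesgue_on {a..b}) (\<lambda>t. norm (L W j t))"
      using L2_on_integrable[OF L_L2(1)[OF W j]] by simp
    then have L_int: "(\<lambda>t. norm (L W j t)) integrable_on {a..b}"
      by (intro integrable_on_lebesgue_on) auto
    then have L_int': "(\<lambda>t. norm (L W j t)) integrable_on {a..y}"
      using y by (auto intro: integrable_on_subinterval)
    have S_int: "(\<lambda>t. C / h0 * S t) integrable_on {a..y}"
      using y by (intro integrable_continuous_real continuous_intros continuous_on_subset[OF S_cont]) auto
    have "norm (W j y) = norm (integral {a..y} (grid_dy a b W j))"
      using weak_deriv_L2_integral[OF w(2)[OF j] w(1)[OF j] y] Wa[OF j] by simp
    also have "\<dots> \<le> integral {a..y} (\<lambda>t. norm (L W j t) + C / h0 * S t)"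
    proof (rule integral_norm_bound_integral[OF dy_int])
      show "(\<lambda>t. norm (L W j t) + C / h0 * S t) integrable_on {a..y}"
        by (intro integrable_add L_int' S_int)
      fix t assume "t \<in> {a..y}"
      then have t: "t \<in> {a..b}" using y by auto
      have "norm (D j t *v grid_dx h W j t) \<le> C * (S t / h0)"
        using D_mult_norm[OF j t] dx_le[OF j t] C by (meson mult_left_mono order.trans)
      then show "norm (grid_dy a b W j t) \<le> norm (L W j t) + C / h0 * S t"
        unfolding dy by (intro order.trans[OF norm_triangle_ineq4]) simp
    qed
    also have "\<dots> = integral {a..y} (\<lambda>t. norm (L W j t)) + C / h0 * integral {a..y} S"
      using L_int' S_int by (simp add: Henstock_Kurzweil_Integration.integral_add)
    \<comment> \<open>Enlarging the interval makes the forcing term independent of y, so that it can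
      serve as the constant in Gronwall's inequality.\<close>
    also have "integral {a..y} (\<lambda>t. norm (L W j t)) \<le> integral {a..b} (\<lambda>t. norm (L W j t))"
      using y L_int L_int' by (intro integral_subset_le) auto
    also have "\<dots> \<le> sqrt ((b - a) * L2_sq a b (L W j))"
      using integral_norm_le_L2[OF L_L2(1)[OF W j] ab] by (rule real_le_rsqrt)
    finally show ?thesis by simp
  qed
  have "S y \<le> F + \<kappa> * C / h0 * integral {a..y} S" if y: "y \<in> {a..b}" for y
  proof -
    have I: "0 \<le> C / h0 * integral {a..y} S"
      using C h0 y S_nonneg S_cont
      by (intro mult_nonneg_nonneg Henstock_Kurzweil_Integration.integral_nonneg
          integrable_continuous_real continuous_on_subset[OF S_cont]) auto
    have "S y \<le> (\<Sum>j\<in>{1..<K}. sqrt ((b - a) * L2_sq a b (L W j)) + C / h0 * integral {a..y} S)"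
      unfolding S_def[of y] by (intro sum_mono W_int y)
    also have "\<dots> = F + real (K - 1) * (C / h0 * integral {a..y} S)"
      by (simp add: F_def sum.distrib)
    also have "\<dots> \<le> F + \<kappa> * (C / h0 * integral {a..y} S)"
      using K I by (intro add_left_mono mult_right_mono) auto
    finally show ?thesis by simp
  qed
  moreover have "0 \<le> \<kappa> * C / h0" using \<kappa> C h0 by simp
  ultimately have S_exp: "S y \<le> F * exp (\<kappa> * C / h0 * (y - a))" if "y \<in> {a..b}" for y
    using gronwall[OF S_cont] that by blast
  have F_nonneg: "0 \<le> F" using ab by (auto simp: F_def intro!: sum_nonneg mult_nonneg_nonneg L2_sq_nonneg)
  have S_le: "S y \<le> F * growth" if y: "y \<in> {a..b}" for y
  proof -
    have "exp (\<kappa> * C / h0 * (y - a)) \<le> growth"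
      unfolding growth_def exp_le_cancel_iff using y \<kappa> C h0 by (intro mult_left_mono) auto
    then show ?thesis
      using S_exp[OF y] F_nonneg by (meson mult_left_mono order.trans)
  qed
  have \<Phi>_nonneg: "0 \<le> \<Phi>" by (simp add: \<Phi>_def sum_nonneg L2_sq_nonneg)
  \<comment> \<open>F has at most \<open>\<kappa>\<close> summands, and each is at most the square
    root of (b - a) \<open>\<Phi>\<close>.\<close>
  have F_sq: "F\<^sup>2 \<le> \<kappa>\<^sup>2 * ((b - a) * \<Phi>)"
  proof -
    have "L2_sq a b (L W j) \<le> \<Phi>" if "j \<in> {1..<K}" for j
      unfolding \<Phi>_def using that L2_sq_nonneg by (intro member_le_sum) auto
    then have "F \<le> (\<Sum>j\<in>{1..<K}. sqrt ((b - a) * \<Phi>))"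
      unfolding F_def using ab by (intro sum_mono) auto
    also have "\<dots> = real (K - 1) * sqrt ((b - a) * \<Phi>)" by simp
    also have "\<dots> \<le> \<kappa> * sqrt ((b - a) * \<Phi>)" using K ab \<Phi>_nonneg by (intro mult_right_mono) auto
    finally have "F\<^sup>2 \<le> (\<kappa> * sqrt ((b - a) * \<Phi>))\<^sup>2" using F_nonneg by (rule power_mono)
    then show ?thesis using ab \<Phi>_nonneg by (simp add: power_mult_distrib)
  qed
  define E where "E = (b - a) * (F * growth)\<^sup>2"
  have E_nonneg: "0 \<le> E" using ab by (simp add: E_def)
  have comp: "L2_sq a b (grid_dx h W j) + L2_sq a b (grid_dy a b W j) + L2_sq a b (W j)
      \<le> 2 * L2_sq a b (L W j) + E * (1 + (1 + 2 * C\<^sup>2) / h0\<^sup>2)" if j: "j \<in> {1..<K}" for j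
  proof -
    have "L2_sq a b (W j) \<le> E"
      unfolding E_def using w(3)[OF j] ab W_le[of j] S_le j
      by (intro L2_on_le_const(2)) (auto simp: L2_on_def intro: order.trans)
    moreover have dx: "L2_sq a b (grid_dx h W j) \<le> E / h0\<^sup>2"
    proof -
      have "norm (grid_dx h W j y) \<le> F * growth / h0" if y: "y \<in> {a..b}" for y
        using dx_le[OF j y] divide_right_mono[OF S_le[OF y], of h0] h0 by linarith
      then have "L2_sq a b (grid_dx h W j) \<le> (b - a) * (F * growth / h0)\<^sup>2"
        using w(4)[OF j] ab by (intro L2_on_le_const(2)) (auto simp: L2_on_def)
      then show ?thesis by (simp add: E_def power_divide)
    qed
    moreover have "L2_sq a b (grid_dy a b W j) \<le> 2 * L2_sq a b (L W j) + 2 * C\<^sup>2 * (E / h0\<^sup>2)"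
    proof -
      have "L2_sq a b (grid_dy a b W j) = L2_sq a b (\<lambda>y. L W j y + (-1) *\<^sub>R (D j y *v grid_dx h W j y))"
        unfolding dy by simp
      also have "\<dots> \<le> 2 * L2_sq a b (L W j) + 2 * L2_sq a b (\<lambda>y. D j y *v grid_dx h W j y)"
        using L2_on_add_scaleR(2)[OF L_L2(1)[OF W j] D_grid_dx_L2(1)[OF W j], of "-1"] by simp
      also have "L2_sq a b (\<lambda>y. D j y *v grid_dx h W j y) \<le> C\<^sup>2 * (E / h0\<^sup>2)"
        using D_grid_dx_L2(2)[OF W j] mult_left_mono[OF dx, of "C\<^sup>2"] by simp
      finally show ?thesis by simp
    qed
    ultimately have "L2_sq a b (grid_dx h W j) + L2_sq a b (grid_dy a b W j) + L2_sq a b (W j)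
      \<le> E / h0\<^sup>2 + (2 * L2_sq a b (L W j) + 2 * C\<^sup>2 * (E / h0\<^sup>2)) + E" by linarith
    then show ?thesis by (simp add: algebra_simps add_divide_distrib)
  qed
  define Q where "Q = 1 + (1 + 2 * C\<^sup>2) / h0\<^sup>2"
  have Q: "0 \<le> Q" by (simp add: Q_def)
  have "(\<Sum>j\<in>{1..<K}. L2_sq a b (grid_dx h W j) + L2_sq a b (grid_dy a b W j) + L2_sq a b (W j))
    \<le> (\<Sum>j\<in>{1..<K}. 2 * L2_sq a b (L W j) + E * Q)"
    unfolding Q_def by (intro sum_mono comp)
  also have "\<dots> = 2 * \<Phi> + real (K - 1) * (E * Q)" by (simp add: \<Phi>_def sum.distrib sum_distrib_left)
  also have "\<dots> \<le> 2 * \<Phi> + \<kappa> * (E * Q)"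
    using K E_nonneg Q by (intro add_left_mono mult_right_mono) auto
  also have "E = (b - a) * growth\<^sup>2 * F\<^sup>2" by (simp add: E_def power_mult_distrib)
  also have "2 * \<Phi> + \<kappa> * ((b - a) * growth\<^sup>2 * F\<^sup>2 * Q)
      \<le> 2 * \<Phi> + \<kappa> * ((b - a) * growth\<^sup>2 * (\<kappa>\<^sup>2 * ((b - a) * \<Phi>)) * Q)"
    using ab \<kappa> Q by (intro add_left_mono mult_left_mono mult_right_mono F_sq) auto
  also have "\<dots> = stability * \<Phi>"
  proof -
    have st: "stability = 2 + \<kappa> ^ 3 * (b - a)\<^sup>2 * growth\<^sup>2 * Q"
      by (simp only: stability_def Q_def)
    show ?thesis
      unfolding st by (simp add: power2_eq_square power3_eq_cube algebra_simps)
  qed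
  \<comment> \<open>Both squared norms carry the same weight h, so none remains in
    \<open>stability\<close>.\<close>
  finally have "h * (\<Sum>j\<in>{1..<K}. L2_sq a b (grid_dx h W j) + L2_sq a b (grid_dy a b W j) + L2_sq a b (W j))
    \<le> h * (stability * \<Phi>)" using h_pos by (intro mult_left_mono) auto
  then show ?thesis
    unfolding H1h_norm_square[OF W h_pos] L_sq_def \<Phi>_def
    by (simp add: sum_distrib_left mult_ac)
qed

section \<open>Error bound for the minimizer\<close>

definition error_factor :: real where
  "error_factor = 2 * stability * (28 + 20 * C\<^sup>2) + 2"

lemma minimizer_error:
  assumes Us: "Us \<in> H1h a b K h" and Ud: "Ud \<in> H1h a b K h" and G: "G \<in> H1h a b K h"
    and L_Us: "L_sq Us = 0" and G_le: "(H1h_norm a b K h G)\<^sup>2 \<le> \<delta>\<^sup>2"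
    and \<epsilon>: "0 \<le> \<epsilon>" "\<epsilon> \<le> 1"
    and min: "L_sq Ud + \<epsilon> * (H1h_norm a b K h Ud)\<^sup>2
      \<le> L_sq (\<lambda>j y. Us j y + G j y) + \<epsilon> * (H1h_norm a b K h (\<lambda>j y. Us j y + G j y))\<^sup>2"
    and bd: "\<And>j. j \<in> {1..<K} \<Longrightarrow> Ud j a = Us j a + G j a"
      "\<And>y. y \<in> {a..b} \<Longrightarrow> Ud 0 y = Us 0 y + G 0 y" "\<And>y. y \<in> {a..b} \<Longrightarrow> Ud K y = Us K y + G K y"
  shows "(H1h_norm a b K h (\<lambda>j y. Ud j y - Us j y))\<^sup>2
    \<le> error_factor * (\<delta>\<^sup>2 + \<epsilon> * (H1h_norm a b K h Us)\<^sup>2)"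
proof -
  let ?N = "\<lambda>U. (H1h_norm a b K h U)\<^sup>2"
  define e where "e = \<epsilon> * ?N Us"
  define q where "q = (1 + C\<^sup>2) * \<delta>\<^sup>2"
  have LG: "L_sq G \<le> 2 * q"
    using L_sq_le_H1h_norm[OF G] mult_left_mono[OF G_le, of "2 * (1 + C\<^sup>2)"]
    by (simp add: q_def algebra_simps)
  have "L_sq (\<lambda>j y. Us j y + G j y) \<le> 2 * L_sq G"
    using L_sq_add_scaleR[OF Us G, of 1] L_Us by simp
  moreover have "\<epsilon> * ?N (\<lambda>j y. Us j y + G j y) \<le> 2 * e + 2 * \<delta>\<^sup>2"
  proof -
    have "\<epsilon> * ?N (\<lambda>j y. Us j y + G j y) \<le> \<epsilon> * (2 * ?N Us + 2 * \<delta>\<^sup>2)"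
      using H1h_norm_add_scaleR[OF Us G h_pos, of 1] G_le \<epsilon> by (intro mult_left_mono) auto
    \<comment> \<open>Here \<open>\<epsilon> \<le> 1\<close> absorbs the penalty of G into its
      squared size.\<close>
    also have "\<dots> \<le> 2 * e + 2 * \<delta>\<^sup>2"
      using mult_right_mono[OF \<epsilon>(2), of "2 * \<delta>\<^sup>2"] by (simp add: e_def algebra_simps)
    finally show ?thesis .
  qed
  moreover have "0 \<le> \<epsilon> * ?N Ud" using \<epsilon> by simp
  ultimately have LUd: "L_sq Ud \<le> 4 * q + 2 * e + 2 * \<delta>\<^sup>2"
    using min LG by linarith
  define V where "V = (\<lambda>j y. Ud j y + (-1) *\<^sub>R Us j y)"
  define W where "W = (\<lambda>j y. V j y + (-1) *\<^sub>R G j y)"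
  have V: "V \<in> H1h a b K h" unfolding V_def by (rule H1h_add_scaleR[OF Ud Us])
  have W: "W \<in> H1h a b K h" unfolding W_def by (rule H1h_add_scaleR[OF V G])
  have "L_sq V \<le> 2 * L_sq Ud"
    using L_sq_add_scaleR[OF Ud Us, of "-1"] L_Us by (simp add: V_def)
  moreover have "L_sq W \<le> 2 * L_sq V + 2 * L_sq G"
    using L_sq_add_scaleR[OF V G, of "-1"] by (simp add: W_def)
  \<comment> \<open>Four times the bound for \<open>L_sq Ud\<close> plus 4q from G. Since q carries
    1 + C^2, the coefficient of the squared noise level is 20(1 + C^2) + 8, which is the 28 + 20C^2
    in \<open>error_factor\<close>.\<close>
  ultimately have "L_sq W \<le> 20 * q + 8 * e + 8 * \<delta>\<^sup>2"
    using LUd LG by linarith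
  also have "\<dots> \<le> (28 + 20 * C\<^sup>2) * (\<delta>\<^sup>2 + e)"
  proof -
    have "0 \<le> e" "0 \<le> C\<^sup>2 * e" using \<epsilon> by (auto simp: e_def)
    then show ?thesis by (simp add: q_def algebra_simps)
  qed
  finally have LW: "L_sq W \<le> (28 + 20 * C\<^sup>2) * (\<delta>\<^sup>2 + e)" .
  have stab: "0 \<le> stability"
    using ab K of_nat_0_le_iff[of K] by (auto simp: stability_def)
  have "?N W \<le> stability * L_sq W"
    by (rule stability_estimate[OF W]) (auto simp: W_def V_def bd)
  also have "\<dots> \<le> stability * ((28 + 20 * C\<^sup>2) * (\<delta>\<^sup>2 + e))"
    by (intro mult_left_mono LW stab)
  finally have NW: "?N W \<le> stability * ((28 + 20 * C\<^sup>2) * (\<delta>\<^sup>2 + e))" .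
  have "(\<lambda>j y. Ud j y - Us j y) = (\<lambda>j y. W j y + 1 *\<^sub>R G j y)"
    by (simp add: W_def V_def fun_eq_iff)
  then have "?N (\<lambda>j y. Ud j y - Us j y) \<le> 2 * ?N W + 2 * ?N G"
    using H1h_norm_add_scaleR[OF W G h_pos, of 1] by simp
  also have "\<dots> \<le> 2 * (stability * ((28 + 20 * C\<^sup>2) * (\<delta>\<^sup>2 + e))) + 2 * (\<delta>\<^sup>2 + e)"
  proof -
    have "0 \<le> e" using \<epsilon> by (simp add: e_def)
    then have "?N G \<le> \<delta>\<^sup>2 + e" using G_le by linarith
    with NW show ?thesis by (intro add_mono mult_left_mono) auto
  qed
  also have "\<dots> = error_factor * (\<delta>\<^sup>2 + e)" by (simp add: error_factor_def algebra_simps)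
  finally show ?thesis by (simp add: e_def)
qed

end

text \<open>The bound in \<open>admissible_a0\<close> is uniform on the closed rectangle, so C can
  be fixed before the mesh is chosen.\<close>

lemma grid_system_D_mat:
  assumes adm: "admissible_a0 TYPE('n::{finite,linorder}) R d a0" and a: "a0 \<le> a" "a < b"
    and R: "0 < R" and h0: "0 < h0"
  obtains C where "\<And>h K. h0 \<le> h \<Longrightarrow> real K = 2 * R / h \<Longrightarrow>
    grid_system a b h h0 (2 * R / h0) C K (\<lambda>j y. D_mat d (grid_pt R h j) y :: 'n rmat)"
proof -
  obtain C1 where C1: "\<And>x y. x \<in> {-R..R} \<Longrightarrow> y \<in> {a..b} \<Longrightarrow>
      invertible (system_mat d x y :: 'n rmat) \<and> norm (D_mat d x y :: 'n rmat) \<le> C1"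
    using adm a unfolding admissible_a0_def by blast
  have a0: "0 < a" using adm a unfolding admissible_a0_def by linarith
  have "grid_system a b h h0 (2 * R / h0) (max 0 C1) K (\<lambda>j y. D_mat d (grid_pt R h j) y :: 'n rmat)"
    if h: "h0 \<le> h" and K: "real K = 2 * R / h" for h K
  proof
    \<comment> \<open>K h = 2R keeps the interior grid points where invertibility and the bound are
      available.\<close>
    have pt: "grid_pt R h j \<in> {-R..R}" if "j \<in> {1..<K}" for j
    proof -
      have "real j * h \<le> real K * h" using that h h0 by (intro mult_right_mono) auto
      also have "\<dots> = 2 * R" using K h h0 by simp
      finally show ?thesis using h h0 by (simp add: grid_pt_def)
    qed
    show "real K \<le> 2 * R / h0" unfolding K using h h0 R by (intro divide_left_mono) auto
    fix j assume j: "j \<in> {1..<K}"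
    show "continuous_on {a..b} (D_mat d (grid_pt R h j) :: real \<Rightarrow> 'n rmat)"
      by (rule D_mat_continuous[OF a0]) (use C1 pt[OF j] in blast)
    show "norm (D_mat d (grid_pt R h j) y :: 'n rmat) \<le> max 0 C1" if "y \<in> {a..b}" for y
      using C1[OF pt[OF j] that] by (simp add: le_max_iff_disj)
  qed (use a h h0 in auto)
  then show ?thesis by (rule that)
qed

theorem theorem4p3:
  fixes R d h0 a0 a b :: real
  assumes "0 < R" and "0 < d" and "0 < h0" and "h0 < 1"
    and "admissible_a0 TYPE('n::{finite,linorder}) R d a0"
    and "a0 \<le> a" and "a < b"
  shows "\<exists>C>0. \<forall>(\<epsilon>::real) (\<delta>::real) (h::real) (K::nat)
      (gs :: real \<times> real \<Rightarrow> 'n rvec) (gd :: real \<times> real \<Rightarrow> 'n rvec)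
      (Fs :: nat \<Rightarrow> real \<Rightarrow> 'n rvec) (Fd :: nat \<Rightarrow> real \<Rightarrow> 'n rvec)
      (Us :: nat \<Rightarrow> real \<Rightarrow> 'n rvec) (Ud :: nat \<Rightarrow> real \<Rightarrow> 'n rvec).
    0 \<le> \<epsilon> \<and> \<epsilon> < 1 \<and> 0 < \<delta> \<and> \<delta> < 1 \<and> h0 \<le> h \<and> h < 1 \<and> real K = 2 * R / h \<and>
    boundary_data R a b gs \<and> boundary_data R a b gd \<and>
    Fs \<in> H1h a b K h \<and> matches_data R a b K h gs Fs \<and>
    Fd \<in> H1h a b K h \<and> matches_data R a b K h gd Fd \<and>
    H1h_norm a b K h (\<lambda>j y. Fd j y - Fs j y) \<le> \<delta> \<and>
    exact_solution d R a b K h gs Us \<and>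
    is_arg_min (functional_J d R a b K h \<epsilon>)
      (\<lambda>U. U \<in> H1h a b K h \<and> matches_data R a b K h gd U) Ud
    \<longrightarrow>
    H1h_norm a b K h (\<lambda>j y. Ud j y - Us j y) \<le> C * (\<delta> + sqrt \<epsilon> * H1h_norm a b K h Us) \<and>
    (\<epsilon> \<le> \<delta>\<^sup>2 \<longrightarrow>
      H1h_norm a b K h (\<lambda>j y. Ud j y - Us j y) \<le> C * (1 + H1h_norm a b K h Us) * \<delta>)"
proof -
  obtain C where sys: "\<And>h K. h0 \<le> h \<Longrightarrow> real K = 2 * R / h \<Longrightarrow>
      grid_system a b h h0 (2 * R / h0) C K (\<lambda>j y. D_mat d (grid_pt R h j) y :: 'n rmat)"
    using grid_system_D_mat[OF assms(5,6,7,1,3)] by blast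
  \<comment> \<open>Outside the locale the factor takes neither h, K nor D as an argument, so A is
    fixed before mesh and data are introduced.\<close>
  define A where "A = grid_system.error_factor a b h0 (2 * R / h0) C"
  \<comment> \<open>The absolute value spares a sign argument for A, and the summand 1 makes c
    positive.\<close>
  define c where "c = 1 + sqrt \<bar>A\<bar>"
  have c: "0 < c" by (simp add: c_def add_pos_nonneg)
  show ?thesis
  proof (rule exI[of _ c], rule conjI[OF c], intro allI impI, elim conjE)
    fix \<epsilon> \<delta> h :: real and K :: nat and gs gd :: "real \<times> real \<Rightarrow> 'n rvec"
      and Fs Fd Us Ud :: "nat \<Rightarrow> real \<Rightarrow> 'n rvec"
    assume \<epsilon>: "0 \<le> \<epsilon>" "\<epsilon> < 1" and \<delta>: "0 < \<delta>"
      and h: "h0 \<le> h" and K: "real K = 2 * R / h"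
      and Fs: "Fs \<in> H1h a b K h" "matches_data R a b K h gs Fs"
      and Fd: "Fd \<in> H1h a b K h" "matches_data R a b K h gd Fd"
      and F_le: "H1h_norm a b K h (\<lambda>j y. Fd j y - Fs j y) \<le> \<delta>"
      and exact: "exact_solution d R a b K h gs Us"
      and min: "is_arg_min (functional_J d R a b K h \<epsilon>)
        (\<lambda>U. U \<in> H1h a b K h \<and> matches_data R a b K h gd U) Ud"
    interpret grid_system a b h h0 "2 * R / h0" C K "\<lambda>j y. D_mat d (grid_pt R h j) y :: 'n rmat"
      by (rule sys[OF h K])
    define G where "G = (\<lambda>j y. Fd j y + (-1) *\<^sub>R Fs j y)"
    have G_eq: "G = (\<lambda>j y. Fd j y - Fs j y)" by (simp add: G_def fun_eq_iff)
    have G: "G \<in> H1h a b K h" unfolding G_def by (rule H1h_add_scaleR[OF Fd(1) Fs(1)])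
    have L_eq: "grid_op d R a b h U = L U" for U
      by (simp add: fun_eq_iff grid_op_def L_def)
    have J_eq: "functional_J d R a b K h \<epsilon> U = L_sq U + \<epsilon> * (H1h_norm a b K h U)\<^sup>2" for U
    proof -
      have "(L2h_norm a b K h (grid_op d R a b h U))\<^sup>2 = L_sq U"
        using L_sq_nonneg[of U] by (simp add: L2h_norm_def L_eq L_sq_def L2_sq_def)
      then show ?thesis by (simp add: functional_J_def)
    qed
    have Us: "Us \<in> H1h a b K h" "matches_data R a b K h gs Us"
      and L_Us: "L_sq Us = 0"
      using exact by (auto simp: exact_solution_def L_eq intro!: L_sq_eq_0)
    have Ud: "Ud \<in> H1h a b K h" "matches_data R a b K h gd Ud"
      using min by (auto simp: is_arg_min_def)
    let ?V = "\<lambda>j y. Us j y + G j y"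
    have "?V \<in> H1h a b K h" using H1h_add_scaleR[OF Us(1) G, of 1] by simp
    \<comment> \<open>G carries the data \<open>gd - gs\<close>, so adding it to \<open>Us\<close>
      turns the data \<open>gs\<close> into \<open>gd\<close>.\<close>
    moreover have "matches_data R a b K h gd ?V"
      using Us(2) Fs(2) Fd(2) by (auto simp: matches_data_def G_eq)
    ultimately have J_le: "L_sq Ud + \<epsilon> * (H1h_norm a b K h Ud)\<^sup>2
        \<le> L_sq ?V + \<epsilon> * (H1h_norm a b K h ?V)\<^sup>2"
      using min unfolding is_arg_min_def J_eq by (meson not_less)
    define x where "x = H1h_norm a b K h (\<lambda>j y. Ud j y - Us j y)"
    define n where "n = H1h_norm a b K h Us"
    have n: "0 \<le> n"
      unfolding n_def H1h_norm_def using h_pos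
      by (auto intro!: sum_nonneg mult_nonneg_nonneg Bochner_Integration.integral_nonneg)
    have G_sq: "(H1h_norm a b K h G)\<^sup>2 \<le> \<delta>\<^sup>2"
    proof (rule power_mono)
      show "H1h_norm a b K h G \<le> \<delta>" using F_le by (simp add: G_eq)
      show "0 \<le> H1h_norm a b K h G"
        unfolding H1h_norm_def using h_pos
        by (auto intro!: sum_nonneg mult_nonneg_nonneg Bochner_Integration.integral_nonneg)
    qed
    have "x\<^sup>2 \<le> A * (\<delta>\<^sup>2 + \<epsilon> * n\<^sup>2)"
      unfolding x_def n_def A_def
    proof (rule minimizer_error[OF Us(1) Ud(1) G L_Us G_sq \<epsilon>(1) less_imp_le[OF \<epsilon>(2)] J_le])
      show "Ud j a = Us j a + G j a" if "j \<in> {1..<K}" for j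
        using that Us(2) Ud(2) Fs(2) Fd(2) by (simp add: matches_data_def G_eq)
      show "Ud 0 y = Us 0 y + G 0 y" "Ud K y = Us K y + G K y" if "y \<in> {a..b}" for y
        using that Us(2) Ud(2) Fs(2) Fd(2) by (simp_all add: matches_data_def G_eq)
    qed
    \<comment> \<open>The added cross term is nonnegative; completing the square allows the root to
      be taken on both sides.\<close>
    also have "\<dots> \<le> \<bar>A\<bar> * (\<delta> + sqrt \<epsilon> * n)\<^sup>2"
    proof (rule mult_mono)
      have "\<epsilon> * n\<^sup>2 = (sqrt \<epsilon> * n)\<^sup>2" using \<epsilon> by (simp add: power_mult_distrib)
      moreover have "0 \<le> \<delta> * (sqrt \<epsilon> * n)" using \<epsilon> \<delta> n by simp
      ultimately show "\<delta>\<^sup>2 + \<epsilon> * n\<^sup>2 \<le> (\<delta> + sqrt \<epsilon> * n)\<^sup>2" by (simp add: power2_sum mult_ac)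
    qed (use \<epsilon> in auto)
    also have "\<dots> = (sqrt \<bar>A\<bar> * (\<delta> + sqrt \<epsilon> * n))\<^sup>2" by (simp add: power_mult_distrib)
    finally have "x \<le> sqrt \<bar>A\<bar> * (\<delta> + sqrt \<epsilon> * n)"
      by (rule power2_le_imp_le) (use \<epsilon> \<delta> n in auto)
    also have "\<dots> \<le> c * (\<delta> + sqrt \<epsilon> * n)"
      using \<epsilon> \<delta> n by (intro mult_right_mono) (auto simp: c_def)
    finally have le: "x \<le> c * (\<delta> + sqrt \<epsilon> * n)" .
    \<comment> \<open>The root of \<open>\<epsilon>\<close> is then at most \<open>\<delta>\<close>,
      and the norm of \<open>Us\<close> moves into the constant.\<close>
    moreover have "x \<le> c * (1 + n) * \<delta>" if "\<epsilon> \<le> \<delta>\<^sup>2"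
    proof -
      have "sqrt \<epsilon> \<le> \<delta>" using that \<delta> by (simp add: real_le_lsqrt)
      then have "c * (\<delta> + sqrt \<epsilon> * n) \<le> c * (\<delta> + \<delta> * n)"
        using n c by (intro mult_left_mono add_left_mono mult_right_mono) auto
      with le show ?thesis by (simp add: algebra_simps)
    qed
    ultimately show "H1h_norm a b K h (\<lambda>j y. Ud j y - Us j y) \<le> c * (\<delta> + sqrt \<epsilon> * H1h_norm a b K h Us) \<and>
        (\<epsilon> \<le> \<delta>\<^sup>2 \<longrightarrow>
          H1h_norm a b K h (\<lambda>j y. Ud j y - Us j y) \<le> c * (1 + H1h_norm a b K h Us) * \<delta>)"
      unfolding x_def n_def by blast
  qed
qed

end
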